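(* Let $A$ be a real symmetric $n\times n$ matrix of rank $r<n$ and let $E=(\xi_{ij})$ be a symmetric $(K,\sigma)$-bounded random $n\times n$ matrix (see context); put $\tilde A=A+E$. Let $\lambda_1\ge\dots\ge\lambda_n$ be the eigenvalues of $A$, let $p\ge 1$ be such that $\lambda_p>0$ and $\delta_p:=\lambda_p-\lambda_{p+1}>0$, and let $\Pi_p$ and $\tilde\Pi_p$ be the orthogonal projections onto the spans of the eigenvectors of the $p$ largest eigenvalues of $A$ and of $\tilde A$, respectively. Assume that, for some choice of $t_1>0$, $$\delta_p\ \ge\ \max\Big\{12\,r\,t_1,\ \frac{144\,r\,\|E\|^2}{|\lambda_p|}\Big\}.$$ Set $\epsilon_1:=\dfrac{\|E\|}{|\lambda_p|}$ and $\epsilon_2:=\dfrac1{\delta_p}$. Then for any $t_2>0$, with probability at least $$1-r^2\exp\Big(\frac{-t_1^2/2}{2\sigma^2+Kt_1}\Big)-\frac{5r(r-1)\,n\,m_4}{2t_2^2},$$ we have $$\|\tilde\Pi_p-\Pi_p\|\ \le\ 12\sqrt p\left(\epsilon_1+\sqrt r\,t_1\epsilon_2+\frac{\sqrt r\,(t_2+\mu)}{\|E\|}\,\epsilon_1\epsilon_2\right),$$ where $$\mu:=\max_{1\le k<l\le r}\Big\{\sum_{i=1}^n u_{ki}u_{li}\sum_{j=1}^n\sigma_{ji}^2\Big\}.$$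
   Context: $\|\cdot\|$ is the spectral norm. $E=(\xi_{ij})_{i,j=1}^n$ is called $(K,\sigma)$-bounded if it is a real symmetric random matrix whose entries $\xi_{ij}$, $1\le i\le j\le n$, are independent with mean zero and variances $\sigma_{ij}^2$, with probability $1$ satisfy $|\xi_{ij}|\le K$ for all $1\le i\le j\le n$, and moreover satisfy $\sigma_{ij}^2\le\sigma^2$ for all $1\le i\le j\le n$ (with $\sigma_{ji}=\sigma_{ij}$). In the definition of $\mu$, $u_1,\dots,u_r$ denote orthonormal eigenvectors of $A$ for its $r$ nonzero eigenvalues (counted with multiplicity), and $u_{ki}$ is the $i$-th coordinate of $u_k$. The quantity $m_4$ is $$m_4:=\max_{1\le i\le n}\frac1n\sum_{j=1}^n\sigma_{ij}^4,$$ where $\sigma_{ij}^4=(\sigma_{ij}^2)^2$ is the square of the variance of $\xi_{ij}$.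
   Formalization: In μ the maximum is taken over absolute values of the sums (and is 0 when r = 1): the signed maximum depends on the arbitrary signs of the eigenvectors u_k and, for some choices, makes the right-hand side negative, so the bound as displayed is false. *)

theory Defs
  imports "HOL-Probability.Probability"
begin

text \<open>Real \<open>n \<times> n\<close> matrices are elements of \<open>real ^ 'n ^ 'n\<close> with \<open>n = CARD('n)\<close>. Eigenvalues and
  eigenvectors are numbered by \<open>1, \<dots>, n\<close> in \<open>nat\<close>, whereas coordinates are numbered by \<open>'n\<close>.\<close>

text \<open>The predefined \<open>norm\<close> on \<open>real ^ 'n ^ 'n\<close> is the Frobenius norm, so the spectral norm has to be
  taken as an operator norm.\<close>

definition spectral_norm :: "real ^ 'n ^ 'n \<Rightarrow> real" where
  "spectral_norm B = onorm (\<lambda>x. B *v x)"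

definition orthonormal_on :: "nat set \<Rightarrow> (nat \<Rightarrow> real ^ 'n) \<Rightarrow> bool" where
  "orthonormal_on I v \<longleftrightarrow> (\<forall>k\<in>I. \<forall>l\<in>I. v k \<bullet> v l = (if k = l then 1 else 0))"

definition sorted_eigensystem ::
    "real ^ 'n ^ 'n \<Rightarrow> (nat \<Rightarrow> real) \<Rightarrow> (nat \<Rightarrow> real ^ 'n) \<Rightarrow> bool" where
  "sorted_eigensystem B lam v \<longleftrightarrow>
     orthonormal_on {1..CARD('n)} v \<and>
     (\<forall>k\<in>{1..CARD('n)}. B *v v k = lam k *\<^sub>R v k) \<and>
     (\<forall>k l. 1 \<le> k \<and> k \<le> l \<and> l \<le> CARD('n) \<longrightarrow> lam l \<le> lam k)"

definition sorted_eigenvalues :: "real ^ 'n ^ 'n \<Rightarrow> (nat \<Rightarrow> real) \<Rightarrow> bool" where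
  "sorted_eigenvalues B lam \<longleftrightarrow> (\<exists>v. sorted_eigensystem B lam v)"

definition orthogonal_projection_onto :: "real ^ 'n ^ 'n \<Rightarrow> (real ^ 'n) set \<Rightarrow> bool" where
  "orthogonal_projection_onto P S \<longleftrightarrow>
     (\<forall>x. P *v x \<in> S \<and> (\<forall>y\<in>S. orthogonal (x - P *v x) y))"

text \<open>A relation rather than a function: if the \<open>p\<close>-th and the \<open>(p+1)\<close>-st eigenvalues of \<open>B\<close>
  coincide, then ``the eigenvectors of the \<open>p\<close> largest eigenvalues'' are a matter of choice, and
  every choice is admitted.\<close>

definition top_eigenprojection :: "nat \<Rightarrow> real ^ 'n ^ 'n \<Rightarrow> real ^ 'n ^ 'n \<Rightarrow> bool" where
  "top_eigenprojection p B P \<longleftrightarrow>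
     (\<exists>lam v. sorted_eigensystem B lam v \<and> orthogonal_projection_onto P (span (v ` {1..p})))"

text \<open>Orthonormal eigenvectors \<open>u 1, \<dots>, u r\<close> for nonzero eigenvalues. When \<open>r = rank A\<close> and \<open>A\<close> is
  symmetric, such a family automatically exhausts the nonzero eigenvalues with multiplicity.\<close>

definition nonzero_eigenvectors :: "real ^ 'n ^ 'n \<Rightarrow> nat \<Rightarrow> (nat \<Rightarrow> real ^ 'n) \<Rightarrow> bool" where
  "nonzero_eigenvectors A r u \<longleftrightarrow>
     orthonormal_on {1..r} u \<and>
     (\<forall>k\<in>{1..r}. \<exists>c. c \<noteq> 0 \<and> A *v u k = c *\<^sub>R u k)"

definition entry_variance ::
    "'w measure \<Rightarrow> ('w \<Rightarrow> real ^ 'n ^ 'n) \<Rightarrow> 'n \<Rightarrow> 'n \<Rightarrow> real" where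
  "entry_variance M E i j = prob_space.variance M (\<lambda>\<omega>. E \<omega> $ i $ j)"

definition bounded_random_matrix ::
    "'w measure \<Rightarrow> real \<Rightarrow> real \<Rightarrow> ('w \<Rightarrow> real ^ 'n::{finite,linorder} ^ 'n::{finite,linorder}) \<Rightarrow> bool" where
  "bounded_random_matrix M K \<sigma> E \<longleftrightarrow>
     (\<forall>\<omega>\<in>space M. transpose (E \<omega>) = E \<omega>) \<and>
     prob_space.indep_vars M (\<lambda>_. borel) (\<lambda>(i, j) \<omega>. E \<omega> $ i $ j) {(i, j). i \<le> j} \<and>
     (\<forall>i j. i \<le> j \<longrightarrow> prob_space.expectation M (\<lambda>\<omega>. E \<omega> $ i $ j) = 0) \<and>
     (AE \<omega> in M. \<forall>i j. i \<le> j \<longrightarrow> \<bar>E \<omega> $ i $ j\<bar> \<le> K) \<and>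
     (\<forall>i j. i \<le> j \<longrightarrow> entry_variance M E i j \<le> \<sigma>\<^sup>2)"

definition m4 :: "'w measure \<Rightarrow> ('w \<Rightarrow> real ^ 'n ^ 'n) \<Rightarrow> real" where
  "m4 M E = Max (range (\<lambda>i. 1 / real CARD('n) * (\<Sum>j\<in>UNIV. (entry_variance M E i j)\<^sup>2)))"

text \<open>Eigenvectors are determined only up to sign, and replacing \<open>u k\<close> by \<open>- u k\<close> changes the sign
  of every sum in which \<open>u k\<close> occurs. The maximum is therefore taken over absolute values: with
  signed sums it would depend on these signs and could be arbitrarily negative. The inserted \<open>0\<close>
  only matters for \<open>r \<le> 1\<close>, where there are no pairs \<open>k < l\<close>.\<close>

definition mu ::
    "'w measure \<Rightarrow> ('w \<Rightarrow> real ^ 'n ^ 'n) \<Rightarrow> nat \<Rightarrow> (nat \<Rightarrow> real ^ 'n) \<Rightarrow> real" where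
  "mu M E r u = Max (insert 0
     {\<bar>\<Sum>i\<in>UNIV. u k $ i * u l $ i * (\<Sum>j\<in>UNIV. entry_variance M E j i)\<bar>
       | k l. 1 \<le> k \<and> k < l \<and> l \<le> r})"

text \<open>For a measurable \<open>Q\<close> this says that the probability of \<open>Q\<close> is at least \<open>q\<close>; the sub-event
  \<open>F\<close> keeps measurability of \<open>Q\<close> out of the statement.\<close>

definition with_prob_at_least :: "'w measure \<Rightarrow> real \<Rightarrow> ('w \<Rightarrow> bool) \<Rightarrow> bool" where
  "with_prob_at_least M q Q \<longleftrightarrow> (\<exists>F\<in>sets M. (\<forall>\<omega>\<in>F. Q \<omega>) \<and> q \<le> measure M F)"

end

theory Submission
  imports Defs
begin

text \<open>Write \<open>\<lambda> = \<lambda>\<^sub>p\<close>, \<open>e = \<parallel>E\<parallel>\<close>, and let \<open>x\<close> bound all \<open>\<bar>\<langle>u\<^sub>k, E u\<^sub>l\<rangle>\<bar>\<close> and \<open>y\<close> bound all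
  \<open>\<bar>\<langle>u\<^sub>k, E\<^sup>2 u\<^sub>l\<rangle>\<bar>\<close> with \<open>k \<noteq> l\<close>. The theorem is a deterministic bound
  \<open>4 \<surd>p (e/\<lambda> + \<surd>r x/\<delta> + \<surd>r y/(\<lambda>\<delta>))\<close>, valid when \<open>r x \<le> \<delta>/6\<close> and \<open>144 e\<^sup>2 \<le> \<lambda>\<delta>\<close>
  (lemma \<open>perturbed_projection_estimate\<close>), combined with tail bounds for \<open>x\<close> and \<open>y\<close>
  (lemma \<open>good_event\<close>).

  Deterministic part. As \<open>r < n\<close>, zero is an eigenvalue, so \<open>\<lambda>\<^bsub>p+1\<^esub> \<ge> 0\<close> and \<open>\<delta> \<le> \<lambda>\<close>. By the
  min-max principle the top \<open>p\<close> eigenvalues \<open>\<nu>\<close> of \<open>A + E\<close> are at least \<open>\<lambda> - \<delta>/6\<close>. Let \<open>w\<close> be a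
  unit eigenvector for such a \<open>\<nu>\<close>, and let \<open>b\<close> be its component orthogonal to the range of \<open>A\<close>.
  Then \<open>\<nu> b\<close> is the same component of \<open>E w\<close>, so \<open>b\<close> has size \<open>O(e/\<lambda>)\<close>. For an eigenvalue
  \<open>\<mu>\<^sub>k \<le> \<lambda> - \<delta>\<close> of \<open>A\<close> one has \<open>(\<nu> - \<mu>\<^sub>k) \<langle>u\<^sub>k, w\<rangle> = \<langle>u\<^sub>k, E w\<rangle>\<close>, where the factor on the left is at
  least \<open>5\<delta>/6\<close>. On the right, the part of \<open>w\<close> in the range of \<open>A\<close> contributes entries
  \<open>\<langle>u\<^sub>k, E u\<^sub>j\<rangle>\<close>; the part \<open>b\<close> is replaced by \<open>1/\<nu>\<close> times a component of \<open>E w\<close>, which produces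
  the entries \<open>\<langle>u\<^sub>k, E\<^sup>2 u\<^sub>j\<rangle>\<close>, always with \<open>k \<noteq> j\<close>, and terms that are small by the gap conditions.
  Summing squares over the \<open>p\<close> eigenvectors, with Bessel's inequality, gives the bound.

  Random part. Exponential moments give \<open>x \<le> 2 t\<^sub>1\<close>, each single entry failing with probability
  at most \<open>2 q\<^sup>2\<close>, where \<open>q\<close> is the exponential in the theorem. The double sum
  \<open>\<langle>u\<^sub>k, E\<^sup>2 u\<^sub>l\<rangle>\<close> splits into three pieces. Its mean is, in absolute value, at most the
  quantity \<open>\<mu>\<close> of the theorem. Its terms with two different entries of \<open>E\<close> have
  second moment at most \<open>2 n m\<^sub>4\<close>, so Chebyshev's inequality applies. Its terms
  \<open>\<xi>\<^sub>i\<^sub>j\<^sup>2 - \<sigma>\<^sub>i\<^sub>j\<^sup>2\<close> cannot be treated in this way: their variances involve fourth moments of the entries,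
  and these are not controlled by \<open>m\<^sub>4\<close>, which contains squared variances only. Instead, their sum
  \<open>D\<close> satisfies the self-normalised inequality \<open>\<bar>D\<bar> \<le> 4 h R\<^sup>2 e\<^sup>2 + L/h\<close> outside an event of
  probability at most \<open>2 exp (-L)\<close>, for \<open>R \<ge> K\<close> and \<open>h R\<^sup>2 \<le> 1/4\<close>.
  For a suitable \<open>h\<close> the condition \<open>144 r e\<^sup>2 \<le> \<lambda>\<delta>\<close> turns this into
  \<open>\<bar>D\<bar> \<le> t\<^sub>1 \<lambda>\<close>, so that \<open>\<surd>r \<bar>D\<bar>/(\<lambda>\<delta>)\<close> is no larger than the first-order term \<open>\<surd>r t\<^sub>1/\<delta>\<close>.

  The room between the constants \<open>4\<close> and \<open>12\<close> pays for \<open>2 t\<^sub>1\<close> instead of \<open>t\<^sub>1\<close> and for \<open>D\<close>. The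
  exponential bounds, over all pairs, cost \<open>4 r\<^sup>2 q\<^sup>2\<close>, which is at most \<open>r\<^sup>2 q\<close> as soon as \<open>r \<ge> 2\<close> and
  \<open>r\<^sup>2 q \<le> 1\<close>. If \<open>r\<^sup>2 q \<ge> 1\<close>, nothing is to be proved, and for \<open>r = 1\<close> the deterministic bound with
  \<open>x = e\<close> suffices for every outcome.\<close>

section \<open>Orthonormal families\<close>

lemma orthonormal_onD:
  assumes "orthonormal_on I u" "k \<in> I" "l \<in> I"
  shows "u k \<bullet> u l = (if k = l then 1 else 0)"
  using assms by (simp add: orthonormal_on_def)

lemma orthonormal_on_subset: "orthonormal_on I u \<Longrightarrow> J \<subseteq> I \<Longrightarrow> orthonormal_on J u"
  unfolding orthonormal_on_def by (meson subsetD)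

lemma orthonormal_on_norm: "orthonormal_on I u \<Longrightarrow> k \<in> I \<Longrightarrow> norm (u k) = 1"
  by (simp add: norm_eq_sqrt_inner orthonormal_onD)

lemma orthonormal_inner_sum:
  assumes "orthonormal_on I u" "J \<subseteq> I" "finite J" "k \<in> I"
  shows "u k \<bullet> (\<Sum>j\<in>J. c j *\<^sub>R u j) = (if k \<in> J then c k else 0)"
proof -
  have "u k \<bullet> (\<Sum>j\<in>J. c j *\<^sub>R u j) = (\<Sum>j\<in>J. c j * (if k = j then 1 else 0))"
    unfolding inner_sum_right inner_scaleR_right
    by (rule sum.cong) (use assms orthonormal_onD[OF assms(1)] in auto)
  then show ?thesis
    using assms(3) by (simp add: sum.delta' if_distrib cong: if_cong)
qed

lemma orthonormal_norm_sum:
  assumes "orthonormal_on I u" "finite I"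
  shows "(norm (\<Sum>j\<in>I. c j *\<^sub>R u j))\<^sup>2 = (\<Sum>j\<in>I. (c j)\<^sup>2)"
proof -
  have "(norm (\<Sum>j\<in>I. c j *\<^sub>R u j))\<^sup>2 = (\<Sum>k\<in>I. c k * (u k \<bullet> (\<Sum>j\<in>I. c j *\<^sub>R u j)))"
    by (simp add: power2_norm_eq_inner inner_sum_left)
  also have "\<dots> = (\<Sum>k\<in>I. c k * c k)"
    by (rule sum.cong) (use assms in \<open>simp_all add: orthonormal_inner_sum[OF assms(1) order_refl]\<close>)
  finally show ?thesis
    by (simp add: power2_eq_square)
qed

text \<open>The orthogonal projection onto the span of \<open>u ` I\<close> when \<open>u\<close> is orthonormal on \<open>I\<close>. Working with
  this formula instead of a matrix keeps the coordinates with respect to \<open>u\<close> visible.\<close>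

definition onproj :: "(nat \<Rightarrow> real ^ 'n) \<Rightarrow> nat set \<Rightarrow> real ^ 'n \<Rightarrow> real ^ 'n" where
  "onproj u I z = (\<Sum>k\<in>I. (u k \<bullet> z) *\<^sub>R u k)"

lemma inner_onproj:
  assumes "orthonormal_on I u" "J \<subseteq> I" "finite J" "k \<in> I"
  shows "u k \<bullet> onproj u J z = (if k \<in> J then u k \<bullet> z else 0)"
  unfolding onproj_def by (rule orthonormal_inner_sum[OF assms])

lemma inner_onproj_swap: "onproj u I y \<bullet> z = y \<bullet> onproj u I z"
  by (simp add: onproj_def inner_sum_left inner_sum_right inner_commute mult.commute)

lemma inner_onproj_self: "z \<bullet> onproj u I z = (\<Sum>k\<in>I. (u k \<bullet> z)\<^sup>2)"
  by (simp add: onproj_def inner_sum_right inner_commute power2_eq_square)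

lemma norm_onproj:
  assumes "orthonormal_on I u" "finite I"
  shows "(norm (onproj u I z))\<^sup>2 = (\<Sum>k\<in>I. (u k \<bullet> z)\<^sup>2)"
  unfolding onproj_def by (rule orthonormal_norm_sum[OF assms])

lemma norm_diff_onproj:
  assumes "orthonormal_on I u" "finite I"
  shows "(norm (z - onproj u I z))\<^sup>2 = (norm z)\<^sup>2 - (\<Sum>k\<in>I. (u k \<bullet> z)\<^sup>2)"
proof -
  have "(norm (z - onproj u I z))\<^sup>2 = (norm z)\<^sup>2 - 2 * (z \<bullet> onproj u I z) + (norm (onproj u I z))\<^sup>2"
    by (simp add: power2_norm_eq_inner algebra_simps inner_commute)
  then show ?thesis
    by (simp add: norm_onproj[OF assms] inner_onproj_self)
qed

lemma bessel:
  assumes "orthonormal_on I u" "finite I"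
  shows "(\<Sum>k\<in>I. (u k \<bullet> z)\<^sup>2) \<le> (norm z)\<^sup>2"
  using norm_diff_onproj[OF assms, of z] by (smt (verit) zero_le_power2)

lemma bessel_L2:
  assumes "orthonormal_on I u" "finite I"
  shows "L2_set (\<lambda>k. u k \<bullet> z) I \<le> norm z"
  unfolding L2_set_def using bessel[OF assms, of z] by (simp add: real_le_lsqrt)

lemma onproj_in_span: "onproj u I z \<in> span (u ` I)"
  unfolding onproj_def by (intro span_sum span_mul span_base) auto

lemma onproj_of_span:
  assumes "orthonormal_on I u" "finite I" "z \<in> span (u ` I)"
  shows "onproj u I z = z"
proof -
  define d where "d = z - onproj u I z"
  have "u k \<bullet> d = 0" if "k \<in> I" for k
    using inner_onproj[OF assms(1) order_refl assms(2) that] that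
    by (simp add: d_def inner_diff_right)
  then have "\<And>y. y \<in> u ` I \<Longrightarrow> orthogonal d y"
    by (auto simp: orthogonal_def inner_commute)
  moreover have "d \<in> span (u ` I)"
    unfolding d_def by (intro span_diff assms onproj_in_span)
  ultimately have "orthogonal d d"
    using orthogonal_to_span by blast
  then show ?thesis
    by (simp add: orthogonal_def d_def)
qed

lemma dim_span_orthonormal:
  fixes u :: "nat \<Rightarrow> real ^ 'n"
  assumes "orthonormal_on I u" "finite I"
  shows "dim (span (u ` I)) = card I"
proof -
  have "inj_on u I"
    by (rule inj_onI) (metis assms(1) orthonormal_onD zero_neq_one)
  moreover have "independent (u ` I)"
  proof (rule pairwise_orthogonal_independent)
    show "pairwise orthogonal (u ` I)"
      using assms(1) by (auto simp: pairwise_def orthogonal_def orthonormal_onD)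
    show "0 \<notin> u ` I"
      using orthonormal_on_norm[OF assms(1)] by force
  qed
  ultimately show ?thesis
    by (simp add: dim_eq_card_independent card_image)
qed

lemma span_orthonormal_UNIV:
  fixes v :: "nat \<Rightarrow> real ^ 'n"
  assumes "orthonormal_on {1..CARD('n)} v"
  shows "span (v ` {1..CARD('n)}) = UNIV"
proof -
  have "dim (span (v ` {1..CARD('n)})) = DIM(real^'n)"
    using dim_span_orthonormal[OF assms] by simp
  then show ?thesis
    by (metis dim_eq_full span_span)
qed

lemma orthogonal_projection_onto_span:
  assumes "orthonormal_on I u" "finite I" "orthogonal_projection_onto P (span (u ` I))"
  shows "P *v z = onproj u I z"
proof -
  define d where "d = P *v z - onproj u I z"
  have "u k \<bullet> d = 0" if "k \<in> I" for k
  proof -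
    have "orthogonal (z - P *v z) (u k)"
      using assms(3) that by (auto simp: orthogonal_projection_onto_def span_base)
    then show ?thesis
      using inner_onproj[OF assms(1) order_refl assms(2) that] that
      by (simp add: d_def inner_diff_right inner_diff_left orthogonal_def inner_commute)
  qed
  then have "onproj u I d = 0"
    by (simp add: onproj_def)
  moreover have "d \<in> span (u ` I)"
    unfolding d_def using assms(3)
    by (intro span_diff onproj_in_span) (auto simp: orthogonal_projection_onto_def)
  ultimately have "d = 0"
    using onproj_of_span[OF assms(1,2)] by force
  then show ?thesis
    by (simp add: d_def)
qed

text \<open>For the projections \<open>P\<close> and \<open>Q\<close> belonging to \<open>u\<close> and \<open>w\<close> one has \<open>Q - P = (1 - P) Q - P (1 - Q)\<close>.
  The first term is controlled by the distances of the vectors \<open>w l\<close> from the first space, the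
  second one by the distances of the vectors \<open>u j\<close> from the second space. Both sums of squared
  distances are equal to \<open>card J - (\<Sum>j\<in>J. \<Sum>l\<in>L. (u j \<bullet> w l)\<^sup>2)\<close> when the dimensions agree.\<close>

lemma norm_onproj_diff_le:
  assumes u: "orthonormal_on J u" "finite J" and w: "orthonormal_on L w" "finite L"
    and card: "card L = card J"
  shows "norm (onproj w L z - onproj u J z)
    \<le> 2 * L2_set (\<lambda>l. norm (w l - onproj u J (w l))) L * norm z"
proof -
  define S where "S = L2_set (\<lambda>l. norm (w l - onproj u J (w l))) L"
  have S2: "S\<^sup>2 = (\<Sum>l\<in>L. (norm (w l - onproj u J (w l)))\<^sup>2)"
    unfolding S_def L2_set_def by (simp add: sum_nonneg)
  have S0: "0 \<le> S"
    by (simp add: S_def)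
  have "S\<^sup>2 = (\<Sum>l\<in>L. 1 - (\<Sum>j\<in>J. (u j \<bullet> w l)\<^sup>2))"
    unfolding S2 by (rule sum.cong) (simp_all add: norm_diff_onproj[OF u] orthonormal_on_norm[OF w(1)])
  also have "\<dots> = (\<Sum>j\<in>J. 1 - (\<Sum>l\<in>L. (w l \<bullet> u j)\<^sup>2))"
    using card by (simp add: sum_subtractf inner_commute sum.swap[of _ J L])
  also have "\<dots> = (\<Sum>j\<in>J. (norm (u j - onproj w L (u j)))\<^sup>2)"
    by (rule sum.cong) (simp_all add: norm_diff_onproj[OF w] orthonormal_on_norm[OF u(1)])
  finally have S2': "S\<^sup>2 = (\<Sum>j\<in>J. (norm (u j - onproj w L (u j)))\<^sup>2)" .
  define y where "y = onproj w L z"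
  have y: "norm y \<le> norm z"
    unfolding y_def using bessel[OF w, of z] norm_onproj[OF w, of z]
    by (metis norm_ge_zero power2_le_imp_le)
  have onproj_lin: "onproj u J (\<Sum>l\<in>L. c l *\<^sub>R w l) = (\<Sum>l\<in>L. c l *\<^sub>R onproj u J (w l))" for c
    by (simp add: onproj_def inner_sum_right scaleR_sum_left scaleR_sum_right sum.swap[of _ J L])
  have "y - onproj u J y = (\<Sum>l\<in>L. (w l \<bullet> z) *\<^sub>R (w l - onproj u J (w l)))"
    unfolding y_def onproj_def[of w] onproj_lin by (simp add: algebra_simps sum_subtractf)
  then have "norm (y - onproj u J y) \<le> (\<Sum>l\<in>L. \<bar>w l \<bullet> z\<bar> * \<bar>norm (w l - onproj u J (w l))\<bar>)"
    by (auto intro!: sum_norm_le)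
  also have "\<dots> \<le> L2_set (\<lambda>l. w l \<bullet> z) L * S"
    unfolding S_def by (rule L2_set_mult_ineq)
  also have "\<dots> \<le> norm z * S"
    by (intro mult_right_mono bessel_L2 w S0)
  finally have a: "norm (y - onproj u J y) \<le> norm z * S" .
  have "(norm (onproj u J (z - y)))\<^sup>2 = (\<Sum>j\<in>J. ((u j - onproj w L (u j)) \<bullet> z)\<^sup>2)"
    unfolding norm_onproj[OF u] y_def
    by (simp add: inner_diff_right inner_diff_left inner_onproj_swap)
  also have "\<dots> \<le> (\<Sum>j\<in>J. (norm (u j - onproj w L (u j)))\<^sup>2 * (norm z)\<^sup>2)"
  proof (rule sum_mono)
    fix j
    have "\<bar>(u j - onproj w L (u j)) \<bullet> z\<bar> \<le> \<bar>norm (u j - onproj w L (u j)) * norm z\<bar>"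
      using Cauchy_Schwarz_ineq2[of "u j - onproj w L (u j)" z] by linarith
    then show "((u j - onproj w L (u j)) \<bullet> z)\<^sup>2 \<le> (norm (u j - onproj w L (u j)))\<^sup>2 * (norm z)\<^sup>2"
      by (metis abs_le_square_iff power_mult_distrib)
  qed
  also have "\<dots> = (norm z * S)\<^sup>2"
    by (simp add: power_mult_distrib S2' sum_distrib_left mult.commute)
  finally have b: "norm (onproj u J (z - y)) \<le> norm z * S"
    by (rule power2_le_imp_le) (simp add: S0)
  have "y - onproj u J z = (y - onproj u J y) - onproj u J (z - y)"
    by (simp add: onproj_def inner_diff_right algebra_simps sum_subtractf)
  then have "norm (y - onproj u J z) \<le> norm (y - onproj u J y) + norm (onproj u J (z - y))"
    by (metis norm_triangle_ineq4)
  with a b show ?thesis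
    unfolding S_def[symmetric] y_def[symmetric] by (simp add: algebra_simps)
qed

section \<open>Spectral norm and the min-max principle\<close>

lemma symmetric_matrix_inner:
  fixes B :: "real ^ 'n ^ 'n"
  assumes "transpose B = B"
  shows "(B *v x) \<bullet> y = x \<bullet> (B *v y)"
  by (metis assms dot_lmul_matrix vector_transpose_matrix)

lemma matrix_vector_mult_sum:
  fixes B :: "real ^ 'n ^ 'n"
  shows "B *v (\<Sum>j\<in>J. c j *\<^sub>R u j) = (\<Sum>j\<in>J. c j *\<^sub>R (B *v u j))"
  by (simp add: linear_sum[OF matrix_vector_mul_linear] linear_scale[OF matrix_vector_mul_linear])

lemma norm_matrix_vector_le: "norm (B *v x) \<le> spectral_norm B * norm x"
  for B :: "real ^ 'n ^ 'n"
  unfolding spectral_norm_def by (rule onorm) simp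

lemma spectral_norm_nonneg: "0 \<le> spectral_norm B"
  unfolding spectral_norm_def by (rule onorm_pos_le) simp

lemma spectral_norm_le: "(\<And>x. norm (B *v x) \<le> b * norm x) \<Longrightarrow> spectral_norm B \<le> b"
  unfolding spectral_norm_def by (rule onorm_le)

text \<open>The half of the min-max principle that bounds eigenvalues from below: a \<open>p\<close>-dimensional space
  must meet the span of \<open>v p, \<dots>, v n\<close>, which has dimension \<open>n - p + 1\<close>, outside zero, and on the
  latter space the quadratic form is at most \<open>lam p\<close>.\<close>

lemma sorted_eigensystem_max_min:
  fixes B :: "real ^ 'n ^ 'n"
  assumes eig: "sorted_eigensystem B lam v" and p: "1 \<le> p" "p \<le> CARD('n)"
    and w: "orthonormal_on J w" "finite J" "card J = p"
    and low: "\<And>z. z \<in> span (w ` J) \<Longrightarrow> c * (norm z)\<^sup>2 \<le> z \<bullet> (B *v z)"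
  shows "c \<le> lam p"
proof -
  define S where "S = span (w ` J)"
  have v: "orthonormal_on {1..CARD('n)} v"
    and Bv: "\<And>k. k \<in> {1..CARD('n)} \<Longrightarrow> B *v v k = lam k *\<^sub>R v k"
    and sorted: "\<And>k l. 1 \<le> k \<Longrightarrow> k \<le> l \<Longrightarrow> l \<le> CARD('n) \<Longrightarrow> lam l \<le> lam k"
    using eig by (auto simp: sorted_eigensystem_def)
  have v': "orthonormal_on {p..CARD('n)} v"
    by (rule orthonormal_on_subset[OF v]) (use p in auto)
  define T where "T = span (v ` {p..CARD('n)})"
  have "dim {x + y |x y. x \<in> S \<and> y \<in> T} + dim (S \<inter> T) = dim S + dim T"
    by (rule dim_sums_Int) (simp_all add: S_def T_def)
  moreover have "dim {x + y |x y. x \<in> S \<and> y \<in> T} \<le> CARD('n)"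
    using dim_subset_UNIV[of "{x + y |x y. x \<in> S \<and> y \<in> T}"] by simp
  moreover have "dim S = p" "dim T = CARD('n) + 1 - p"
    unfolding S_def T_def using dim_span_orthonormal[OF w(1,2)] dim_span_orthonormal[OF v'] w(3)
    by simp_all
  ultimately have "dim (S \<inter> T) \<noteq> 0"
    using p by linarith
  then obtain z where z: "z \<in> S" "z \<in> T" "z \<noteq> 0"
    by (metis Int_iff dim_eq_0 insertI1 subsetI)
  have zexp: "z = (\<Sum>k\<in>{p..CARD('n)}. (v k \<bullet> z) *\<^sub>R v k)"
    using onproj_of_span[OF v' _ z(2)[unfolded T_def]] by (simp add: onproj_def)
  have "B *v z = (\<Sum>k\<in>{p..CARD('n)}. (v k \<bullet> z) *\<^sub>R (B *v v k))"
    by (subst zexp) (rule matrix_vector_mult_sum)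
  also have "\<dots> = (\<Sum>k\<in>{p..CARD('n)}. (v k \<bullet> z) *\<^sub>R (lam k *\<^sub>R v k))"
    by (rule sum.cong) (use p Bv in auto)
  finally have "z \<bullet> (B *v z) = (\<Sum>k\<in>{p..CARD('n)}. lam k * (v k \<bullet> z)\<^sup>2)"
    by (simp add: inner_sum_right inner_commute power2_eq_square mult_ac)
  also have "\<dots> \<le> (\<Sum>k\<in>{p..CARD('n)}. lam p * (v k \<bullet> z)\<^sup>2)"
    by (intro sum_mono mult_right_mono) (use sorted p in auto)
  also have "\<dots> = lam p * (norm z)\<^sup>2"
    using norm_onproj[OF v', of z] onproj_of_span[OF v' _ z(2)[unfolded T_def]]
    by (simp add: sum_distrib_left)
  finally have "c * (norm z)\<^sup>2 \<le> lam p * (norm z)\<^sup>2"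
    using low z(1) unfolding S_def by fastforce
  then show ?thesis
    using z(3) by simp
qed

section \<open>A deterministic bound for perturbed eigenprojections\<close>

lemma sum_squares_le_card_mult:
  assumes "finite K" "\<And>k. k \<in> K \<Longrightarrow> (f k)\<^sup>2 \<le> b"
  shows "(\<Sum>k\<in>K. (f k)\<^sup>2) \<le> real (card K) * b"
  using sum_bounded_above[of K "\<lambda>k. (f k)\<^sup>2" b] assms by simp

text \<open>The operator norm is bounded by the Frobenius norm, which costs a factor \<open>r\<close>. This
  loss is affordable wherever smallness of \<open>r * x\<close> compared with the gap is sufficient.\<close>

lemma bounded_entries_L2_le:
  fixes G :: "nat \<Rightarrow> nat \<Rightarrow> real"
  assumes fin: "finite K" "finite J"
    and G: "\<And>k j. k \<in> K \<Longrightarrow> j \<in> J \<Longrightarrow> \<bar>G k j\<bar> \<le> x" and x: "0 \<le> x"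
    and r: "card K \<le> r" "card J \<le> r"
  shows "L2_set (\<lambda>k. \<Sum>j\<in>J. G k j * c j) K \<le> real r * x * L2_set c J"
proof -
  have row: "(\<Sum>j\<in>J. G k j * c j)\<^sup>2 \<le> real r * x\<^sup>2 * (L2_set c J)\<^sup>2" if k: "k \<in> K" for k
  proof -
    have "(\<Sum>j\<in>J. (G k j)\<^sup>2) \<le> real (card J) * x\<^sup>2"
    proof (rule sum_squares_le_card_mult[OF fin(2)])
      show "(G k j)\<^sup>2 \<le> x\<^sup>2" if "j \<in> J" for j
        using G[OF k that] by (metis abs_le_square_iff abs_of_nonneg x)
    qed
    also have "\<dots> \<le> real r * x\<^sup>2"
      using r by (intro mult_right_mono) auto
    finally have "(\<Sum>j\<in>J. (G k j)\<^sup>2) * (\<Sum>j\<in>J. (c j)\<^sup>2) \<le> real r * x\<^sup>2 * (\<Sum>j\<in>J. (c j)\<^sup>2)"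
      by (intro mult_right_mono) (auto simp: sum_nonneg)
    then show ?thesis
      using Cauchy_Schwarz_ineq_sum[of "G k" c J] by (simp add: L2_set_def sum_nonneg)
  qed
  have "(\<Sum>k\<in>K. (\<Sum>j\<in>J. G k j * c j)\<^sup>2) \<le> real (card K) * (real r * x\<^sup>2 * (L2_set c J)\<^sup>2)"
    by (rule sum_squares_le_card_mult[OF fin(1) row])
  also have "\<dots> \<le> real r * (real r * x\<^sup>2 * (L2_set c J)\<^sup>2)"
    using r by (intro mult_right_mono) auto
  also have "\<dots> = (real r * x * L2_set c J)\<^sup>2"
    by (simp add: power2_eq_square)
  finally show ?thesis
    unfolding L2_set_def[of _ K] by (rule real_le_lsqrt[rotated -1]) (use x in \<open>auto simp: sum_nonneg\<close>)
qed

text \<open>Summing over an orthonormal family first, by Bessel's inequality row by row, replaces the factor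
  \<open>r\<close> of an operator norm bound by \<open>sqrt (card K * card J)\<close>. This is the source of the factors
  \<open>sqrt p\<close> and \<open>sqrt r\<close> in the final estimate.\<close>

lemma bounded_entries_orthonormal_le:
  fixes G :: "nat \<Rightarrow> nat \<Rightarrow> real"
  assumes u: "orthonormal_on J u" "finite J" and w: "orthonormal_on L w" "finite L"
    and K: "finite K" and G: "\<And>k j. k \<in> K \<Longrightarrow> j \<in> J \<Longrightarrow> \<bar>G k j\<bar> \<le> x" and x: "0 \<le> x"
  shows "L2_set (\<lambda>l. L2_set (\<lambda>k. \<Sum>j\<in>J. G k j * (u j \<bullet> w l)) K) L
     \<le> sqrt (real (card K) * real (card J)) * x"
proof -
  define h where "h k = (\<Sum>j\<in>J. G k j *\<^sub>R u j)" for k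
  have hw: "(\<Sum>j\<in>J. G k j * (u j \<bullet> w l)) = w l \<bullet> h k" for k l
    by (simp add: h_def inner_sum_right inner_commute)
  have h: "(norm (h k))\<^sup>2 \<le> real (card J) * x\<^sup>2" if k: "k \<in> K" for k
  proof -
    have "(norm (h k))\<^sup>2 = (\<Sum>j\<in>J. (G k j)\<^sup>2)"
      unfolding h_def by (rule orthonormal_norm_sum[OF u])
    also have "\<dots> \<le> real (card J) * x\<^sup>2"
    proof (rule sum_squares_le_card_mult[OF u(2)])
      show "(G k j)\<^sup>2 \<le> x\<^sup>2" if "j \<in> J" for j
        using G[OF k that] by (metis abs_le_square_iff abs_of_nonneg x)
    qed
    finally show ?thesis .
  qed
  have "(\<Sum>l\<in>L. (L2_set (\<lambda>k. w l \<bullet> h k) K)\<^sup>2) = (\<Sum>k\<in>K. \<Sum>l\<in>L. (w l \<bullet> h k)\<^sup>2)"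
    by (simp add: L2_set_def sum_nonneg sum.swap[of _ K L])
  also have "\<dots> \<le> (\<Sum>k\<in>K. (norm (h k))\<^sup>2)"
    by (intro sum_mono bessel[OF w])
  also have "\<dots> \<le> real (card K) * (real (card J) * x\<^sup>2)"
    by (rule sum_squares_le_card_mult[OF K h])
  finally show ?thesis
    unfolding hw L2_set_def[of _ L]
    by (intro real_le_lsqrt[rotated -1]) (use x in \<open>auto simp: sum_nonneg power_mult_distrib mult_ac\<close>)
qed

lemma L2_set_scale: "0 \<le> a \<Longrightarrow> L2_set (\<lambda>k. a * f k) K = a * L2_set f K"
  by (simp add: L2_set_right_distrib)

lemma L2_set_minus: "L2_set (\<lambda>k. - f k) K = L2_set f K"
  by (simp add: L2_set_def)

text \<open>The core of the deterministic argument, for a single eigenvector \<open>w\<close> of \<open>A + E\<close>. Testing the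
  eigenvalue equation against \<open>u k\<close> with \<open>k \<in> I - J\<close> divides by \<open>nu - \<mu> k \<ge> 5 / 6 * del\<close>.
  The two sums on the right are left unestimated, since they become small only after
  averaging over several eigenvectors.\<close>

lemma perturbed_eigenvector_estimate:
  fixes A E :: "real ^ 'n ^ 'n" and u :: "nat \<Rightarrow> real ^ 'n"
  assumes u: "orthonormal_on I u" and fin: "finite I" and cI: "card I = r" and JI: "J \<subseteq> I"
    and Au: "\<And>k. k \<in> I \<Longrightarrow> A *v u k = \<mu> k *\<^sub>R u k"
    and A0: "\<And>z. (\<And>k. k \<in> I \<Longrightarrow> u k \<bullet> z = 0) \<Longrightarrow> A *v z = 0"
    and lo: "\<And>k. k \<in> I - J \<Longrightarrow> \<mu> k \<le> lam - del"
    and del: "0 < del" "del \<le> lam"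
    and x: "\<And>k l. k \<in> I \<Longrightarrow> l \<in> I \<Longrightarrow> \<bar>u k \<bullet> (E *v u l)\<bar> \<le> x" "0 \<le> x"
    and small: "real r * x \<le> del / 6" "144 * (spectral_norm E)\<^sup>2 \<le> lam * del"
    and w: "norm w = 1" "(A + E) *v w = nu *\<^sub>R w" and nu: "lam - del / 6 \<le> nu"
  shows "norm (w - onproj u J w) \<le> 2 * (
      L2_set (\<lambda>k. \<Sum>j\<in>J. (u k \<bullet> (E *v u j)) * (u j \<bullet> w)) (I - J) / del
    + L2_set (\<lambda>k. \<Sum>j\<in>J. (u k \<bullet> (E *v (E *v u j))) * (u j \<bullet> w)) (I - J) / (lam * del)
    + spectral_norm E / lam)"
proof -
  define e where "e = spectral_norm E"
  define K where "K = I - J"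
  define c where "c k = u k \<bullet> w" for k
  define b where "b = w - onproj u I w"
  define wK where "wK = onproj u K w"
  define W where "W = L2_set c K"
  have e0: "0 \<le> e"
    by (simp add: e_def spectral_norm_nonneg)
  have En: "norm (E *v z) \<le> e * norm z" for z
    unfolding e_def by (rule norm_matrix_vector_le)
  have finK: "finite K" and KI: "K \<subseteq> I"
    using fin JI by (auto simp: K_def finite_subset)
  note uK = orthonormal_on_subset[OF u KI]
  have cK: "card K \<le> r" and cI': "card I \<le> r"
    using card_mono[OF fin KI] cI by auto
  have lam0: "0 < lam"
    using del by linarith
  have nu56: "5 / 6 * lam \<le> nu" and nu0: "0 < nu"
    using nu del by linarith+
  have split: "w = onproj u J w + wK + b"
  proof -
    have "onproj u I w = onproj u J w + onproj u K w"
      unfolding onproj_def K_def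
      using sum.subset_diff[OF JI fin, of "\<lambda>k. (u k \<bullet> w) *\<^sub>R u k"] by (simp add: add.commute)
    then show ?thesis
      by (simp add: b_def wK_def)
  qed
  have ub: "u k \<bullet> b = 0" if "k \<in> I" for k
    using inner_onproj[OF u order_refl fin that] that by (simp add: b_def inner_diff_right)
  have Ab: "A *v b = 0"
    by (rule A0[OF ub])
  have Aw: "A *v w = (\<Sum>k\<in>I. (\<mu> k * c k) *\<^sub>R u k)"
  proof -
    have "A *v w = A *v onproj u I w + A *v b"
      by (simp add: b_def matrix_vector_mult_diff_distrib)
    also have "\<dots> = (\<Sum>k\<in>I. c k *\<^sub>R (A *v u k))"
      by (simp add: Ab onproj_def c_def matrix_vector_mult_sum)
    also have "\<dots> = (\<Sum>k\<in>I. (\<mu> k * c k) *\<^sub>R u k)"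
      by (rule sum.cong) (simp_all add: Au)
    finally show ?thesis .
  qed
  have eigw: "nu *\<^sub>R w = A *v w + E *v w"
    using w(2) by (simp add: matrix_vector_mult_add_rdistrib)
  have comp: "nu * c k = \<mu> k * c k + u k \<bullet> (E *v w)" if k: "k \<in> I" for k
  proof -
    have "nu * c k = u k \<bullet> (A *v w) + u k \<bullet> (E *v w)"
      unfolding c_def by (metis eigw inner_add_right inner_scaleR_right)
    also have "u k \<bullet> (A *v w) = \<mu> k * c k"
      unfolding Aw using orthonormal_inner_sum[OF u order_refl fin k] k by simp
    finally show ?thesis .
  qed
  have nub: "nu *\<^sub>R b = E *v w - onproj u I (E *v w)"
  proof -
    have "nu *\<^sub>R onproj u I w = (\<Sum>k\<in>I. (nu * c k) *\<^sub>R u k)"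
      by (simp add: onproj_def scaleR_sum_right c_def)
    also have "\<dots> = (\<Sum>k\<in>I. (\<mu> k * c k + u k \<bullet> (E *v w)) *\<^sub>R u k)"
      by (rule sum.cong) (simp_all add: comp)
    also have "\<dots> = A *v w + onproj u I (E *v w)"
      by (simp add: Aw onproj_def scaleR_left_distrib sum.distrib)
    finally show ?thesis
      by (simp add: b_def scaleR_right_diff_distrib eigw)
  qed
  have Ew: "norm (E *v w) \<le> e"
    using En[of w] w(1) by simp
  have nb: "norm b \<le> 6 / 5 * e / lam"
  proof -
    have "nu * norm b = norm (E *v w - onproj u I (E *v w))"
      using nub nu0 by (metis abs_of_pos norm_scaleR)
    also have "(norm (E *v w - onproj u I (E *v w)))\<^sup>2 \<le> (norm (E *v w))\<^sup>2"
      using norm_diff_onproj[OF u fin] by (simp add: sum_nonneg)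
    then have "norm (E *v w - onproj u I (E *v w)) \<le> norm (E *v w)"
      by (rule power2_le_imp_le) simp
    finally have "nu * norm b \<le> e"
      using Ew by linarith
    moreover have "5 / 6 * lam * norm b \<le> nu * norm b"
      by (intro mult_right_mono nu56) simp
    ultimately show ?thesis
      using lam0 by (simp add: field_simps)
  qed
  have wKexp: "wK = (\<Sum>k\<in>K. c k *\<^sub>R u k)"
    by (simp add: wK_def onproj_def c_def)
  have nwK: "norm wK = W"
  proof (rule power2_eq_imp_eq)
    show "(norm wK)\<^sup>2 = W\<^sup>2"
      unfolding wKexp orthonormal_norm_sum[OF uK finK] by (simp add: W_def L2_set_def sum_nonneg)
  qed (simp_all add: W_def)
  \<comment> \<open>The first-order terms \<open>f1\<close>, \<open>f2\<close> come from the part of \<open>w\<close> in the range of \<open>A\<close>. The others come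
    from \<open>b\<close>, after substituting \<open>nu * b = E *v w - onproj u I (E *v w)\<close> and splitting \<open>w\<close> once more.\<close>
  define f1 where "f1 k = (\<Sum>j\<in>J. (u k \<bullet> (E *v u j)) * c j)" for k
  define f2 where "f2 k = (\<Sum>j\<in>K. (u k \<bullet> (E *v u j)) * c j)" for k
  define f3 where "f3 k = (\<Sum>j\<in>J. (u k \<bullet> (E *v (E *v u j))) * c j)" for k
  define f4 where "f4 k = u k \<bullet> (E *v (E *v wK))" for k
  define f5 where "f5 k = u k \<bullet> (E *v (E *v b))" for k
  define f6 where "f6 k = (\<Sum>j\<in>I. (u k \<bullet> (E *v u j)) * (u j \<bullet> (E *v w)))" for k
  note Esum = matrix_vector_mult_sum[of E _ u]
  have EEsum: "E *v (E *v (\<Sum>j\<in>X. d j *\<^sub>R u j)) = (\<Sum>j\<in>X. d j *\<^sub>R (E *v (E *v u j)))" for d X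
    by (simp only: matrix_vector_mult_sum)
  have ukEw: "u k \<bullet> (E *v w) = f1 k + f2 k + u k \<bullet> (E *v b)" for k
  proof -
    have "E *v w = E *v onproj u J w + E *v wK + E *v b"
      by (subst split) (simp add: matrix_vector_right_distrib)
    then show ?thesis
      unfolding f1_def f2_def wKexp onproj_def Esum c_def
      by (simp add: inner_add_right inner_sum_right mult.commute)
  qed
  have ukEb: "nu * (u k \<bullet> (E *v b)) = f3 k + f4 k + f5 k - f6 k" for k
  proof -
    have "nu * (u k \<bullet> (E *v b)) = u k \<bullet> (E *v (nu *\<^sub>R b))"
      by (simp add: linear_scale[OF matrix_vector_mul_linear])
    also have "\<dots> = u k \<bullet> (E *v (E *v w)) - u k \<bullet> (E *v onproj u I (E *v w))"
      by (simp add: nub matrix_vector_mult_diff_distrib inner_diff_right)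
    also have "u k \<bullet> (E *v onproj u I (E *v w)) = f6 k"
      unfolding f6_def onproj_def Esum by (simp add: inner_sum_right mult.commute)
    also have "E *v (E *v w) = E *v (E *v onproj u J w) + E *v (E *v wK) + E *v (E *v b)"
      by (subst split) (simp add: matrix_vector_right_distrib)
    then have "u k \<bullet> (E *v (E *v w)) = f3 k + f4 k + f5 k"
      unfolding f3_def f4_def f5_def onproj_def EEsum c_def
      by (simp add: inner_add_right inner_sum_right mult.commute)
    finally show ?thesis .
  qed
  have key: "(nu - \<mu> k) * c k
      = f1 k + (f2 k + (1 / nu * f3 k + (1 / nu * f4 k + (1 / nu * f5 k + - (1 / nu * f6 k)))))" if "k \<in> K" for k
  proof -
    have "(nu - \<mu> k) * c k = f1 k + f2 k + u k \<bullet> (E *v b)"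
      using comp[of k] ukEw[of k] that KI by (simp add: algebra_simps subset_iff)
    also have "u k \<bullet> (E *v b) = (f3 k + f4 k + f5 k - f6 k) / nu"
      using ukEb[of k] nu0 by (simp add: field_simps)
    finally show ?thesis
      by (simp add: diff_divide_distrib add_divide_distrib)
  qed
  have tri: "L2_set (\<lambda>k. f k + g k) K \<le> a + b'" if "L2_set f K \<le> a" "L2_set g K \<le> b'" for f g :: "nat \<Rightarrow> real" and a b'
    using L2_set_triangle_ineq[of f g K] that by linarith
  have F2: "L2_set f2 K \<le> real r * x * W"
    unfolding f2_def W_def
    by (rule bounded_entries_L2_le) (use finK cK x KI in \<open>auto simp: subset_iff\<close>)
  have EE: "norm (E *v (E *v z)) \<le> e\<^sup>2 * norm z" for z
  proof -
    have "norm (E *v (E *v z)) \<le> e * norm (E *v z)"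
      by (rule En)
    also have "\<dots> \<le> e * (e * norm z)"
      by (intro mult_left_mono En e0)
    finally show ?thesis
      by (simp add: power2_eq_square)
  qed
  have F4: "L2_set f4 K \<le> e\<^sup>2 * W"
    unfolding f4_def using bessel_L2[OF uK finK, of "E *v (E *v wK)"] EE[of wK] nwK by simp
  have F5: "L2_set f5 K \<le> e\<^sup>2 * norm b"
    unfolding f5_def using bessel_L2[OF uK finK, of "E *v (E *v b)"] EE[of b] by simp
  have F6: "L2_set f6 K \<le> real r * x * e"
  proof -
    have "L2_set f6 K \<le> real r * x * L2_set (\<lambda>j. u j \<bullet> (E *v w)) I"
      unfolding f6_def
      by (rule bounded_entries_L2_le) (use finK fin cK cI' x KI in \<open>auto simp: subset_iff\<close>)
    also have "\<dots> \<le> real r * x * e"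
      using bessel_L2[OF u fin, of "E *v w"] Ew x by (intro mult_left_mono) auto
    finally show ?thesis .
  qed
  define \<alpha> where "\<alpha> = L2_set f1 K"
  define \<beta> where "\<beta> = L2_set f3 K"
  have W0: "0 \<le> W" and \<alpha>0: "0 \<le> \<alpha>" and \<beta>0: "0 \<le> \<beta>"
    by (simp_all add: W_def \<alpha>_def \<beta>_def)
  have up: "L2_set (\<lambda>k. (nu - \<mu> k) * c k) K
      \<le> \<alpha> + (real r * x * W + (1 / nu * \<beta> + (1 / nu * (e\<^sup>2 * W) + (1 / nu * (e\<^sup>2 * norm b)
          + 1 / nu * (real r * x * e)))))"
  proof -
    have "L2_set (\<lambda>k. (nu - \<mu> k) * c k) K = L2_set (\<lambda>k. f1 k + (f2 k + (1 / nu * f3 k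
        + (1 / nu * f4 k + (1 / nu * f5 k + - (1 / nu * f6 k)))))) K"
      by (rule L2_set_cong) (simp_all add: key)
    also have "\<dots> \<le> \<alpha> + (real r * x * W + (1 / nu * \<beta> + (1 / nu * (e\<^sup>2 * W) + (1 / nu * (e\<^sup>2 * norm b)
          + 1 / nu * (real r * x * e)))))"
      using F2 F4 F5 F6 nu0 
      by (intro tri) (simp_all only: L2_set_minus L2_set_scale \<alpha>_def \<beta>_def order_refl
          mult_left_mono divide_nonneg_pos zero_le_one less_imp_le zero_le_divide_1_iff)
    finally show ?thesis .
  qed
  have "5 / 6 * del * W = L2_set (\<lambda>k. 5 / 6 * del * c k) K"
    using L2_set_scale[of "5 / 6 * del" c K] del by (simp add: W_def)
  also have "\<dots> \<le> L2_set (\<lambda>k. (nu - \<mu> k) * c k) K"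
    unfolding L2_set_def
  proof (intro real_sqrt_le_mono sum_mono)
    fix k assume "k \<in> K"
    then have "\<bar>5 / 6 * del\<bar> \<le> \<bar>nu - \<mu> k\<bar>"
      using lo[of k] nu del by (simp add: K_def)
    then have "(5 / 6 * del)\<^sup>2 \<le> (nu - \<mu> k)\<^sup>2"
      by (simp only: abs_le_square_iff)
    then show "(5 / 6 * del * c k)\<^sup>2 \<le> ((nu - \<mu> k) * c k)\<^sup>2"
      unfolding power_mult_distrib by (intro mult_right_mono) auto
  qed
  also note up
  finally have main: "5 / 6 * del * W \<le> \<alpha> + real r * x * W
      + (\<beta> + e\<^sup>2 * W + e\<^sup>2 * norm b + real r * x * e) / nu"
    by (simp add: add_divide_distrib)
  have e2: "144 * e\<^sup>2 \<le> lam * del"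
    using small(2) by (simp add: e_def)
  have t1: "real r * x * W \<le> del / 6 * W"
    by (intro mult_right_mono small W0)
  have t2: "e\<^sup>2 * W \<le> lam * del / 144 * W"
    by (intro mult_right_mono W0) (use e2 in simp)
  have t3: "e\<^sup>2 * norm b \<le> lam * del / 144 * (6 / 5 * e / lam)"
    by (intro mult_mono nb) (use e2 lam0 del in auto)
  have t4: "real r * x * e \<le> del / 6 * e"
    by (intro mult_right_mono small e0)
  \<comment> \<open>All terms containing \<open>W\<close> have total coefficient at most \<open>(1 / 6 + 1 / 120) * del\<close> and are absorbed
    into \<open>5 / 6 * del * W\<close>.\<close>
  have "(\<beta> + e\<^sup>2 * W + e\<^sup>2 * norm b + real r * x * e) / nu
      \<le> (\<beta> + e\<^sup>2 * W + e\<^sup>2 * norm b + real r * x * e) / (5 / 6 * lam)"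
    by (intro divide_left_mono nu56) (use \<beta>0 W0 e0 x nu0 lam0 in \<open>auto intro!: add_nonneg_nonneg\<close>)
  also have "\<dots> \<le> (\<beta> + lam * del / 144 * W + lam * del / 144 * (6 / 5 * e / lam) + del / 6 * e) / (5 / 6 * lam)"
    by (intro divide_right_mono add_mono t2 t3 t4) (use lam0 in auto)
  also have "\<dots> = 6 / 5 * \<beta> / lam + del * W / 120 + (21 / 100) * del * e / lam"
    using lam0 by (simp add: field_simps)
  finally have "5 / 6 * del * W \<le> \<alpha> + del / 6 * W + (6 / 5 * \<beta> / lam + del * W / 120 + (21 / 100) * del * e / lam)"
    using main t1 by linarith
  then have "79 / 120 * (del * W) \<le> \<alpha> + 6 / 5 * \<beta> / lam + (21 / 100) * del * e / lam"
    by (simp add: algebra_simps)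
  then have "79 / 120 * (del * W) / del \<le> (\<alpha> + 6 / 5 * \<beta> / lam + (21 / 100) * del * e / lam) / del"
    by (rule divide_right_mono) (use del in simp)
  also have "\<dots> = \<alpha> / del + 6 / 5 * (\<beta> / (lam * del)) + 21 / 100 * (e / lam)"
    using del lam0 by (simp add: field_simps)
  finally have Wb: "79 / 120 * W \<le> \<alpha> / del + 6 / 5 * (\<beta> / (lam * del)) + 21 / 100 * (e / lam)"
    using del by simp
  have "norm (w - onproj u J w) \<le> norm wK + norm b"
    by (subst (1) split) (simp add: norm_triangle_ineq)
  also have "\<dots> \<le> W + 6 / 5 * (e / lam)"
    using nwK nb by simp
  finally have fin: "norm (w - onproj u J w) \<le> W + 6 / 5 * (e / lam)" .
  have arith: "n \<le> 2 * (a1 + a2 + a3)" if "0 \<le> a1" "0 \<le> a2" "0 \<le> a3"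
      "79 / 120 * W \<le> a1 + 6 / 5 * a2 + 21 / 100 * a3" "n \<le> W + 6 / 5 * a3" for a1 a2 a3 n :: real
    using that by (simp add: field_simps)
  have "0 \<le> \<alpha> / del" "0 \<le> \<beta> / (lam * del)" "0 \<le> e / lam"
    using \<alpha>0 \<beta>0 e0 del lam0 by auto
  then have "norm (w - onproj u J w) \<le> 2 * (\<alpha> / del + \<beta> / (lam * del) + e / lam)"
    using arith[OF _ _ _ Wb fin] by simp
  then show ?thesis
    unfolding \<alpha>_def \<beta>_def e_def K_def f1_def f3_def c_def .
qed

text \<open>The test space is the unperturbed eigenspace, on which the quadratic form of \<open>E\<close> sees only the
  small entries \<open>u k \<bullet> (E *v u l)\<close>. The trivial bound \<open>lam - spectral_norm E\<close> would be too weak, since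
  \<open>spectral_norm E\<close> may exceed the gap.\<close>

lemma perturbed_top_eigenvalues_lower_bound:
  fixes A E :: "real ^ 'n ^ 'n" and u :: "nat \<Rightarrow> real ^ 'n"
  assumes u: "orthonormal_on J u" and fin: "finite J" and cJ: "card J = p"
    and p: "1 \<le> p" "p \<le> CARD('n)"
    and Au: "\<And>k. k \<in> J \<Longrightarrow> A *v u k = \<mu> k *\<^sub>R u k"
    and hi: "\<And>k. k \<in> J \<Longrightarrow> lam \<le> \<mu> k"
    and x: "\<And>k l. k \<in> J \<Longrightarrow> l \<in> J \<Longrightarrow> \<bar>u k \<bullet> (E *v u l)\<bar> \<le> x" "0 \<le> x"
    and w: "sorted_eigensystem (A + E) nu w"
  shows "lam - real p * x \<le> nu p"
proof (rule sorted_eigensystem_max_min[OF w p u fin cJ])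
  fix z assume z: "z \<in> span (u ` J)"
  define c where "c k = u k \<bullet> z" for k
  have zc: "z = (\<Sum>k\<in>J. c k *\<^sub>R u k)"
    using onproj_of_span[OF u fin z] by (simp add: onproj_def c_def)
  have nz: "(norm z)\<^sup>2 = (\<Sum>k\<in>J. (c k)\<^sup>2)"
    by (subst zc) (rule orthonormal_norm_sum[OF u fin])
  have L2: "L2_set c J * L2_set c J = (norm z)\<^sup>2"
    unfolding nz L2_set_def by (simp add: sum_nonneg)
  have zB: "z \<bullet> (B *v z) = (\<Sum>k\<in>J. c k * (u k \<bullet> (B *v z)))" for B :: "real ^ 'n ^ 'n"
    by (subst (1) zc) (simp add: inner_sum_left)
  have "lam * (norm z)\<^sup>2 \<le> (\<Sum>k\<in>J. \<mu> k * (c k)\<^sup>2)"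
    unfolding nz sum_distrib_left by (intro sum_mono mult_right_mono hi) auto
  also have "\<dots> = z \<bullet> (A *v z)"
  proof -
    have "A *v z = (\<Sum>k\<in>J. (c k * \<mu> k) *\<^sub>R u k)"
      unfolding zc matrix_vector_mult_sum by (rule sum.cong) (simp_all add: Au)
    then have "z \<bullet> (A *v z) = (\<Sum>k\<in>J. c k * (c k * \<mu> k))"
      unfolding zB by (intro sum.cong) (simp_all add: orthonormal_inner_sum[OF u order_refl fin])
    then show ?thesis
      by (simp add: power2_eq_square mult_ac)
  qed
  finally have a: "lam * (norm z)\<^sup>2 \<le> z \<bullet> (A *v z)" .
  have ukE: "u k \<bullet> (E *v z) = (\<Sum>j\<in>J. (u k \<bullet> (E *v u j)) * c j)" for k
    by (subst zc) (simp add: matrix_vector_mult_sum inner_sum_right mult.commute)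
  have "- (z \<bullet> (E *v z)) \<le> (\<Sum>k\<in>J. \<bar>c k\<bar> * \<bar>u k \<bullet> (E *v z)\<bar>)"
    unfolding zB sum_negf[symmetric] by (intro sum_mono) (simp add: abs_mult[symmetric])
  also have "\<dots> \<le> L2_set c J * L2_set (\<lambda>k. u k \<bullet> (E *v z)) J"
    by (rule L2_set_mult_ineq)
  also have "\<dots> \<le> L2_set c J * (real p * x * L2_set c J)"
    unfolding ukE by (intro mult_left_mono bounded_entries_L2_le) (use fin x cJ in auto)
  also have "\<dots> = real p * x * (norm z)\<^sup>2"
    using L2 by (simp add: mult_ac)
  finally show "(lam - real p * x) * (norm z)\<^sup>2 \<le> z \<bullet> ((A + E) *v z)"
    using a by (simp add: matrix_vector_mult_add_rdistrib inner_add_right left_diff_distrib)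
qed

text \<open>The estimates of the single eigenvectors are added up in the Euclidean norm over \<open>{1..p}\<close>. The
  second-order bound \<open>y\<close> refers to pairs of indices on different sides of the gap, and this
  matters: a diagonal entry \<open>u k \<bullet> (E *v (E *v u k))\<close> may be as large as \<open>(spectral_norm E)\<^sup>2\<close>.\<close>

lemma perturbed_projection_estimate:
  fixes A E :: "real ^ 'n ^ 'n" and u :: "nat \<Rightarrow> real ^ 'n"
  assumes u: "orthonormal_on I u" and fin: "finite I" and cI: "card I = r" and JI: "J \<subseteq> I"
    and cJ: "card J = p" and p: "1 \<le> p" "p \<le> CARD('n)"
    and Au: "\<And>k. k \<in> I \<Longrightarrow> A *v u k = \<mu> k *\<^sub>R u k"
    and A0: "\<And>z. (\<And>k. k \<in> I \<Longrightarrow> u k \<bullet> z = 0) \<Longrightarrow> A *v z = 0"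
    and hi: "\<And>k. k \<in> J \<Longrightarrow> lam \<le> \<mu> k" and lo: "\<And>k. k \<in> I - J \<Longrightarrow> \<mu> k \<le> lam - del"
    and del: "0 < del" "del \<le> lam"
    and x: "\<And>k l. k \<in> I \<Longrightarrow> l \<in> I \<Longrightarrow> \<bar>u k \<bullet> (E *v u l)\<bar> \<le> x" "0 \<le> x"
    and y: "\<And>k l. k \<in> I - J \<Longrightarrow> l \<in> J \<Longrightarrow> \<bar>u k \<bullet> (E *v (E *v u l))\<bar> \<le> y" "0 \<le> y"
    and small: "real r * x \<le> del / 6" "144 * (spectral_norm E)\<^sup>2 \<le> lam * del"
    and w: "sorted_eigensystem (A + E) nu w"
  shows "norm (onproj w {1..p} z - onproj u J z) \<le> 4 * sqrt (real p) *
    (spectral_norm E / lam + sqrt (real r) * x / del + sqrt (real r) * y / (lam * del)) * norm z"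
proof -
  define L where "L = {1..p}"
  define K where "K = I - J"
  define e where "e = spectral_norm E"
  have finJ: "finite J" and finK: "finite K" and KI: "K \<subseteq> I"
    using fin JI by (auto simp: K_def finite_subset)
  have pr: "p \<le> r" and cK: "card K \<le> r"
    using card_mono[OF fin JI] card_mono[OF fin KI] cJ cI by auto
  note uJ = orthonormal_on_subset[OF u JI]
  have wO: "orthonormal_on {1..CARD('n)} w"
    and ww: "\<And>l. l \<in> {1..CARD('n)} \<Longrightarrow> (A + E) *v w l = nu l *\<^sub>R w l"
    and mono: "\<And>k l. 1 \<le> k \<Longrightarrow> k \<le> l \<Longrightarrow> l \<le> CARD('n) \<Longrightarrow> nu l \<le> nu k"
    using w by (auto simp: sorted_eigensystem_def)
  have LN: "L \<subseteq> {1..CARD('n)}" and finL: "finite L"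
    using p by (auto simp: L_def)
  note wL = orthonormal_on_subset[OF wO LN]
  have "real p * x \<le> real r * x"
    using pr x(2) by (intro mult_right_mono) auto
  moreover have "lam - real p * x \<le> nu p"
    by (rule perturbed_top_eigenvalues_lower_bound[OF uJ finJ cJ p _ _ _ x(2) w, of \<mu>])
       (use Au hi x JI in \<open>auto simp: subset_iff\<close>)
  ultimately have nu: "lam - del / 6 \<le> nu l" if "l \<in> L" for l
    using mono[of l p] that p small by (force simp: L_def)
  define \<alpha> where "\<alpha> l = L2_set (\<lambda>k. \<Sum>j\<in>J. (u k \<bullet> (E *v u j)) * (u j \<bullet> w l)) K" for l
  define \<beta> where "\<beta> l = L2_set (\<lambda>k. \<Sum>j\<in>J. (u k \<bullet> (E *v (E *v u j))) * (u j \<bullet> w l)) K" for l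
  have est: "norm (w l - onproj u J (w l)) \<le> 2 / del * \<alpha> l + (2 / (lam * del) * \<beta> l + 2 * e / lam)"
    if l: "l \<in> L" for l
  proof -
    have "norm (w l - onproj u J (w l)) \<le> 2 * (\<alpha> l / del + \<beta> l / (lam * del) + e / lam)"
      unfolding \<alpha>_def \<beta>_def K_def e_def
      by (rule perturbed_eigenvector_estimate[OF u fin cI JI Au A0 lo del x small _ _ nu[OF l]])
         (use l LN ww orthonormal_on_norm[OF wL l] in auto)
    then show ?thesis
      by (simp add: algebra_simps)
  qed
  have sq: "sqrt (real (card X) * real (card J)) \<le> sqrt (real p) * sqrt (real r)" if "card X \<le> r" for X :: "nat set"
    using that by (simp add: cJ real_sqrt_mult[symmetric] mult.commute mult_left_mono)
  have \<alpha>: "L2_set \<alpha> L \<le> sqrt (real p) * sqrt (real r) * x"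
  proof -
    have "L2_set \<alpha> L \<le> sqrt (real (card K) * real (card J)) * x"
      unfolding \<alpha>_def by (rule bounded_entries_orthonormal_le[OF uJ finJ wL finL finK])
        (use x KI JI in \<open>auto simp: subset_iff\<close>)
    also have "\<dots> \<le> sqrt (real p) * sqrt (real r) * x"
      by (intro mult_right_mono sq cK x)
    finally show ?thesis .
  qed
  have \<beta>: "L2_set \<beta> L \<le> sqrt (real p) * sqrt (real r) * y"
  proof -
    have "L2_set \<beta> L \<le> sqrt (real (card K) * real (card J)) * y"
      unfolding \<beta>_def by (rule bounded_entries_orthonormal_le[OF uJ finJ wL finL finK])
        (use y in \<open>auto simp: K_def\<close>)
    also have "\<dots> \<le> sqrt (real p) * sqrt (real r) * y"
      by (intro mult_right_mono sq cK y)
    finally show ?thesis .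
  qed
  have e0: "0 \<le> e"
    by (simp add: e_def spectral_norm_nonneg)
  have c: "L2_set (\<lambda>l. 2 * e / lam) L = sqrt (real p) * (2 * e / lam)"
    unfolding L2_set_def L_def using e0 del by (simp add: real_sqrt_mult power_divide real_sqrt_divide)
  have a: "L2_set (\<lambda>l. 2 / del * \<alpha> l) L = 2 / del * L2_set \<alpha> L"
    and b: "L2_set (\<lambda>l. 2 / (lam * del) * \<beta> l) L = 2 / (lam * del) * L2_set \<beta> L"
    using del by (intro L2_set_scale; simp)+
  have "L2_set (\<lambda>l. norm (w l - onproj u J (w l))) L
      \<le> L2_set (\<lambda>l. 2 / del * \<alpha> l + (2 / (lam * del) * \<beta> l + 2 * e / lam)) L"
    by (rule L2_set_mono) (use est in auto)
  also have "\<dots> \<le> L2_set (\<lambda>l. 2 / del * \<alpha> l) L + L2_set (\<lambda>l. 2 / (lam * del) * \<beta> l + 2 * e / lam) L"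
    by (rule L2_set_triangle_ineq)
  also have "\<dots> \<le> L2_set (\<lambda>l. 2 / del * \<alpha> l) L + (L2_set (\<lambda>l. 2 / (lam * del) * \<beta> l) L + L2_set (\<lambda>l. 2 * e / lam) L)"
    by (intro add_left_mono L2_set_triangle_ineq)
  also have "\<dots> = 2 / del * L2_set \<alpha> L + (2 / (lam * del) * L2_set \<beta> L + sqrt (real p) * (2 * e / lam))"
    unfolding c a b ..
  also have "\<dots> \<le> 2 / del * (sqrt (real p) * sqrt (real r) * x)
      + (2 / (lam * del) * (sqrt (real p) * sqrt (real r) * y) + sqrt (real p) * (2 * e / lam))"
    using del by (intro add_mono mult_left_mono \<alpha> \<beta>) auto
  also have "\<dots> = 2 * sqrt (real p) * (e / lam + sqrt (real r) * x / del + sqrt (real r) * y / (lam * del))"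
    by (simp add: algebra_simps)
  finally have S: "2 * L2_set (\<lambda>l. norm (w l - onproj u J (w l))) L
      \<le> 4 * sqrt (real p) * (e / lam + sqrt (real r) * x / del + sqrt (real r) * y / (lam * del))"
    by simp
  have "norm (onproj w L z - onproj u J z) \<le> 2 * L2_set (\<lambda>l. norm (w l - onproj u J (w l))) L * norm z"
    by (rule norm_onproj_diff_le[OF uJ finJ wL finL]) (simp add: L_def cJ)
  also have "\<dots> \<le> 4 * sqrt (real p) * (e / lam + sqrt (real r) * x / del + sqrt (real r) * y / (lam * del)) * norm z"
    by (intro mult_right_mono S) simp
  finally show ?thesis
    unfolding L_def e_def .
qed

text \<open>Applied in both directions, this shows that sorted eigenvalues do not depend on the choice of
  the eigenvectors.\<close>

lemma sorted_eigensystem_le: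
  fixes B :: "real ^ 'n ^ 'n"
  assumes a: "sorted_eigensystem B lam v" and b: "sorted_eigensystem B lam' v'"
    and p: "1 \<le> p" "p \<le> CARD('n)"
  shows "lam p \<le> lam' p"
proof -
  have v: "orthonormal_on {1..CARD('n)} v"
    and Bv: "\<And>l. l \<in> {1..CARD('n)} \<Longrightarrow> B *v v l = lam l *\<^sub>R v l"
    and mono: "\<And>k l. 1 \<le> k \<Longrightarrow> k \<le> l \<Longrightarrow> l \<le> CARD('n) \<Longrightarrow> lam l \<le> lam k"
    using a by (auto simp: sorted_eigensystem_def)
  have "lam p - real p * 0 \<le> lam' p"
    by (rule perturbed_top_eigenvalues_lower_bound[of "{1..p}" v p B lam "lam p" 0 0 lam' v'])
       (use p mono Bv orthonormal_on_subset[OF v] b in auto)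
  then show ?thesis
    by simp
qed

section \<open>Eigenvectors of a symmetric matrix of low rank\<close>

text \<open>Every \<open>u k\<close> lies in the range because its eigenvalue can be inverted, and \<open>r\<close> orthonormal vectors
  in an \<open>r\<close>-dimensional space span it.\<close>

lemma nonzero_eigenvectors_span_range:
  fixes A :: "real ^ 'n ^ 'n"
  assumes "rank A = r" "nonzero_eigenvectors A r u"
  shows "span (u ` {1..r}) = range (\<lambda>x. A *v x)"
proof (rule subspace_dim_equal)
  show "subspace (range (\<lambda>x. A *v x))"
    by (intro linear_subspace_image matrix_vector_mul_linear) simp
  have "u k \<in> range (\<lambda>x. A *v x)" if k: "k \<in> {1..r}" for k
  proof -
    obtain c where c: "c \<noteq> 0" "A *v u k = c *\<^sub>R u k"
      using assms(2) k unfolding nonzero_eigenvectors_def by blast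
    then have "A *v ((1 / c) *\<^sub>R u k) = u k"
      by (simp add: linear_scale[OF matrix_vector_mul_linear])
    then show ?thesis
      by (metis rangeI)
  qed
  then show "span (u ` {1..r}) \<subseteq> range (\<lambda>x. A *v x)"
    by (intro span_minimal \<open>subspace (range (\<lambda>x. A *v x))\<close>) auto
  have "dim (span (u ` {1..r})) = r"
    using assms(2) dim_span_orthonormal[of "{1..r}" u] by (simp add: nonzero_eigenvectors_def)
  then show "dim (range (\<lambda>x. A *v x)) \<le> dim (span (u ` {1..r}))"
    using assms(1) by (simp add: rank_dim_range)
qed simp

lemma nonzero_eigenvectors_orthogonal_kernel:
  fixes A :: "real ^ 'n ^ 'n"
  assumes sym: "transpose A = A" and "rank A = r" "nonzero_eigenvectors A r u"
    and z: "\<And>k. k \<in> {1..r} \<Longrightarrow> u k \<bullet> z = 0"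
  shows "A *v z = 0"
proof -
  have "A *v (A *v z) \<in> span (u ` {1..r})"
    using nonzero_eigenvectors_span_range[OF assms(2,3)] by simp
  moreover have "\<And>y. y \<in> u ` {1..r} \<Longrightarrow> orthogonal z y"
    using z by (auto simp: orthogonal_def inner_commute)
  ultimately have "orthogonal z (A *v (A *v z))"
    using orthogonal_to_span by blast
  then show ?thesis
    using symmetric_matrix_inner[OF sym, of z "A *v z"] by (simp add: orthogonal_def)
qed

text \<open>The top eigenspace is described by a sorted eigensystem \<open>v\<close>, whereas the entries of \<open>E\<close> refer to
  the eigenvectors \<open>u\<close>, which come in no particular order. Eigenvectors for different eigenvalues
  are orthogonal; together with the gap this identifies both spans.\<close>

lemma top_eigenspace_in_nonzero_eigenvectors:
  fixes A :: "real ^ 'n ^ 'n"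
  assumes sym: "transpose A = A" and rank: "rank A = r" and ne: "nonzero_eigenvectors A r u"
    and eig: "sorted_eigensystem A lam v" and p: "1 \<le> p" "p < CARD('n)"
    and pos: "0 < lam p" and gap: "lam (p + 1) < lam p"
    and Au: "\<And>k. k \<in> {1..r} \<Longrightarrow> A *v u k = \<mu> k *\<^sub>R u k"
  defines "J \<equiv> {k \<in> {1..r}. lam p \<le> \<mu> k}"
  shows "card J = p" "span (v ` {1..p}) = span (u ` J)"
    "\<And>k. k \<in> {1..r} - J \<Longrightarrow> \<mu> k \<le> lam (p + 1)"
proof -
  have u: "orthonormal_on {1..r} u"
    using ne by (simp add: nonzero_eigenvectors_def)
  have v: "orthonormal_on {1..CARD('n)} v"
    and Av: "\<And>l. l \<in> {1..CARD('n)} \<Longrightarrow> A *v v l = lam l *\<^sub>R v l"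
    and mono: "\<And>k l. 1 \<le> k \<Longrightarrow> k \<le> l \<Longrightarrow> l \<le> CARD('n) \<Longrightarrow> lam l \<le> lam k"
    using eig by (auto simp: sorted_eigensystem_def)
  have orth: "v i \<bullet> u k = 0" if "i \<in> {1..CARD('n)}" "k \<in> {1..r}" "lam i \<noteq> \<mu> k" for i k
  proof -
    have "lam i * (v i \<bullet> u k) = \<mu> k * (v i \<bullet> u k)"
      using symmetric_matrix_inner[OF sym, of "v i" "u k"] Av[OF that(1)] Au[OF that(2)] by simp
    then show ?thesis
      using that by simp
  qed
  have vexp: "z = (\<Sum>i\<in>{1..CARD('n)}. (v i \<bullet> z) *\<^sub>R v i)" for z
    using onproj_of_span[OF v, of z] span_orthonormal_UNIV[OF v] by (simp add: onproj_def)
  have sub: "{1..p} \<subseteq> {1..CARD('n)}" and JI: "J \<subseteq> {1..r}" and finJ: "finite J"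
    using p by (auto simp: J_def)
  note vp = orthonormal_on_subset[OF v sub] and uJ = orthonormal_on_subset[OF u JI]
  have "u k \<in> span (v ` {1..p})" if "k \<in> J" for k
  proof -
    have "(v i \<bullet> u k) *\<^sub>R v i \<in> span (v ` {1..p})" if i: "i \<in> {1..CARD('n)}" for i
    proof (cases "i \<le> p")
      case True
      then show ?thesis
        using i by (intro span_mul span_base) auto
    next
      case False
      then have "lam i \<noteq> \<mu> k"
        using mono[of "p + 1" i] i gap \<open>k \<in> J\<close> by (auto simp: J_def)
      then show ?thesis
        using orth[OF i] \<open>k \<in> J\<close> by (simp add: J_def span_zero)
    qed
    then show ?thesis
      by (subst vexp) (rule span_sum)
  qed
  moreover have "v i \<in> span (u ` J)" if i: "i \<in> {1..p}" for i
  proof -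
    have iN: "i \<in> {1..CARD('n)}" and li: "lam p \<le> lam i"
      using i p mono[of i p] by auto
    have "v i = A *v ((1 / lam i) *\<^sub>R v i)"
      using Av[OF iN] li pos by (simp add: linear_scale[OF matrix_vector_mul_linear])
    then have "v i \<in> span (u ` {1..r})"
      unfolding nonzero_eigenvectors_span_range[OF rank ne] by (metis rangeI)
    then have "v i = (\<Sum>k\<in>{1..r}. (u k \<bullet> v i) *\<^sub>R u k)"
      using onproj_of_span[OF u] by (simp add: onproj_def)
    moreover have "(u k \<bullet> v i) *\<^sub>R u k \<in> span (u ` J)" if k: "k \<in> {1..r}" for k
    proof (cases "k \<in> J")
      case True
      then show ?thesis
        by (intro span_mul span_base) auto
    next
      case False
      then have "lam i \<noteq> \<mu> k"
        using li k by (auto simp: J_def)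
      then show ?thesis
        using orth[OF iN k] by (simp add: inner_commute span_zero)
    qed
    ultimately show ?thesis
      by (metis (no_types, lifting) span_sum)
  qed
  ultimately show span: "span (v ` {1..p}) = span (u ` J)"
    by (simp add: span_eq image_subset_iff)
  show "card J = p"
    using dim_span_orthonormal[OF vp finite_atLeastAtMost] dim_span_orthonormal[OF uJ finJ]
    unfolding span by simp
  show "\<mu> k \<le> lam (p + 1)" if k: "k \<in> {1..r} - J" for k
  proof (rule ccontr)
    assume contr: "\<not> \<mu> k \<le> lam (p + 1)"
    have "v i \<bullet> u k = 0" if i: "i \<in> {1..CARD('n)}" for i
    proof (rule orth[OF i])
      show "lam i \<noteq> \<mu> k"
      proof (cases "i \<le> p")
        case True
        then show ?thesis
          using mono[of i p] i p k by (auto simp: J_def)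
      next
        case False
        then show ?thesis
          using mono[of "p + 1" i] i contr by auto
      qed
    qed (use k in auto)
    then have "u k = 0"
      by (subst vexp) simp
    then show False
      using orthonormal_on_norm[OF u, of k] k by simp
  qed
qed

text \<open>If the eigenvalues jumped over zero, \<open>A\<close> would be invertible. Consequently the gap never exceeds
  \<open>lam p\<close>.\<close>

lemma eigenvalue_after_gap_nonneg:
  fixes A :: "real ^ 'n ^ 'n"
  assumes eig: "sorted_eigensystem A lam v" and p: "1 \<le> p" "p < CARD('n)" and pos: "0 < lam p"
    and rank: "rank A < CARD('n)"
  shows "0 \<le> lam (p + 1)"
proof (rule ccontr)
  assume neg: "\<not> 0 \<le> lam (p + 1)"
  have v: "orthonormal_on {1..CARD('n)} v"
    and Av: "\<And>l. l \<in> {1..CARD('n)} \<Longrightarrow> A *v v l = lam l *\<^sub>R v l"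
    and mono: "\<And>k l. 1 \<le> k \<Longrightarrow> k \<le> l \<Longrightarrow> l \<le> CARD('n) \<Longrightarrow> lam l \<le> lam k"
    using eig by (auto simp: sorted_eigensystem_def)
  have "v i \<in> range (\<lambda>x. A *v x)" if i: "i \<in> {1..CARD('n)}" for i
  proof -
    have "lam i \<noteq> 0"
      using mono[of i p] mono[of "p + 1" i] i p pos neg by (cases "i \<le> p") auto
    then have "A *v ((1 / lam i) *\<^sub>R v i) = v i"
      using Av[OF i] by (simp add: linear_scale[OF matrix_vector_mul_linear])
    then show ?thesis
      by (metis rangeI)
  qed
  then have "span (v ` {1..CARD('n)}) \<subseteq> range (\<lambda>x. A *v x)"
    by (intro span_minimal linear_subspace_image matrix_vector_mul_linear) auto
  then have "range (\<lambda>x. A *v x) = UNIV"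
    using span_orthonormal_UNIV[OF v] by auto
  then show False
    using rank by (simp add: rank_dim_range)
qed

section \<open>Exponential and second moments of independent bounded variables\<close>

lemma exp_le_quadratic:
  fixes v :: real
  assumes "\<bar>v\<bar> \<le> 1"
  shows "exp v \<le> 1 + v + v\<^sup>2"
proof (cases "0 \<le> v")
  case True
  then show ?thesis
    using assms exp_bound[of v] by simp
next
  case False
  define x where "x = - v"
  have x: "0 \<le> x"
    using False by (simp add: x_def)
  have "1 \<le> (1 - x + x\<^sup>2) * (1 + x)"
    using x by (simp add: algebra_simps power2_eq_square power3_eq_cube)
  also have "\<dots> \<le> (1 - x + x\<^sup>2) * exp x"
  proof (rule mult_left_mono)
    show "0 \<le> 1 - x + x\<^sup>2"
      using False assms by (simp add: x_def)
  qed (simp add: exp_ge_add_one_self)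
  finally have "exp (- x) * 1 \<le> exp (- x) * ((1 - x + x\<^sup>2) * exp x)"
    by (intro mult_left_mono) auto
  also have "\<dots> = 1 - x + x\<^sup>2"
    by (simp add: exp_minus field_simps)
  finally show ?thesis
    by (simp add: x_def)
qed

context prob_space
begin

text \<open>The exponential Markov inequality, phrased for moment generating functions because it is applied
  to multiples of the entries as well as to multiples of their squares.\<close>

lemma indep_sum_exponential_tail:
  fixes X :: "'i \<Rightarrow> 'a \<Rightarrow> real"
  assumes fin: "finite I" and ind: "indep_vars (\<lambda>_. borel) X I"
    and bd: "\<And>i. i \<in> I \<Longrightarrow> AE \<omega> in M. X i \<omega> \<le> B i"
    and mgf: "\<And>i. i \<in> I \<Longrightarrow> expectation (\<lambda>\<omega>. exp (X i \<omega>)) \<le> exp (m i)"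
  shows "prob {\<omega> \<in> space M. (\<Sum>i\<in>I. m i) + L \<le> (\<Sum>i\<in>I. X i \<omega>)} \<le> exp (- L)"
proof -
  have meas[measurable]: "X i \<in> borel_measurable M" if "i \<in> I" for i
    using ind that by (auto simp: indep_vars_def)
  have ind': "indep_vars (\<lambda>_. borel) (\<lambda>i \<omega>. exp (X i \<omega>)) I"
    by (rule indep_vars_compose2[OF ind]) simp
  have int: "integrable M (\<lambda>\<omega>. exp (X i \<omega>))" if i: "i \<in> I" for i
  proof (rule integrable_const_bound[of _ "exp (B i)"])
    show "AE \<omega> in M. norm (exp (X i \<omega>)) \<le> exp (B i)"
      using bd[OF i] by eventually_elim simp
  qed (use i in measurable)
  have es: "exp (\<Sum>i\<in>I. X i \<omega>) = (\<Prod>i\<in>I. exp (X i \<omega>))" for \<omega>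
    by (rule exp_sum[OF fin])
  have intp: "integrable M (\<lambda>\<omega>. exp (\<Sum>i\<in>I. X i \<omega>))"
    unfolding es by (rule indep_vars_integrable[OF fin ind' int])
  have "prob {\<omega> \<in> space M. (\<Sum>i\<in>I. m i) + L \<le> (\<Sum>i\<in>I. X i \<omega>)}
      \<le> prob {\<omega> \<in> space M. exp ((\<Sum>i\<in>I. m i) + L) \<le> exp (\<Sum>i\<in>I. X i \<omega>)}"
    by simp
  also have "\<dots> \<le> expectation (\<lambda>\<omega>. exp (\<Sum>i\<in>I. X i \<omega>)) / exp ((\<Sum>i\<in>I. m i) + L)"
    by (rule integral_Markov_inequality_measure[OF intp sets.empty_sets]) auto
  also have "\<dots> = (\<Prod>i\<in>I. expectation (\<lambda>\<omega>. exp (X i \<omega>))) / exp ((\<Sum>i\<in>I. m i) + L)"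
    unfolding es by (simp add: indep_vars_lebesgue_integral[OF fin ind' int])
  also have "\<dots> \<le> (\<Prod>i\<in>I. exp (m i)) / exp ((\<Sum>i\<in>I. m i) + L)"
    by (intro divide_right_mono prod_mono) (use mgf in auto)
  also have "\<dots> = exp (- L)"
    by (simp add: exp_sum[OF fin, symmetric] exp_add exp_minus field_simps)
  finally show ?thesis .
qed

lemma centred_mgf_le:
  fixes X :: "'a \<Rightarrow> real" and K \<theta> :: real
  assumes [measurable]: "X \<in> borel_measurable M" and bd: "AE \<omega> in M. \<bar>X \<omega>\<bar> \<le> K"
    and mean: "expectation X = 0" and \<theta>: "\<bar>\<theta>\<bar> * K \<le> 1"
  shows "expectation (\<lambda>\<omega>. exp (\<theta> * X \<omega>)) \<le> exp (\<theta>\<^sup>2 * expectation (\<lambda>\<omega>. (X \<omega>)\<^sup>2))"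
proof -
  have intX: "integrable M X"
    by (rule integrable_const_bound[of _ K]) (use bd in auto)
  have intX2: "integrable M (\<lambda>\<omega>. (X \<omega>)\<^sup>2)"
  proof (rule integrable_const_bound[of _ "K\<^sup>2"])
    show "AE \<omega> in M. norm ((X \<omega>)\<^sup>2) \<le> K\<^sup>2"
      using bd by eventually_elim (simp add: abs_le_square_iff[symmetric])
  qed simp
  have small: "\<bar>\<theta> * X \<omega>\<bar> \<le> 1" if "\<bar>X \<omega>\<bar> \<le> K" for \<omega>
    using mult_left_mono[OF that, of "\<bar>\<theta>\<bar>"] \<theta> by (simp add: abs_mult)
  have inte: "integrable M (\<lambda>\<omega>. exp (\<theta> * X \<omega>))"
  proof (rule integrable_const_bound[of _ "exp 1"])
    show "AE \<omega> in M. norm (exp (\<theta> * X \<omega>)) \<le> exp 1"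
      using bd by eventually_elim (use small in force)
  qed simp
  have "expectation (\<lambda>\<omega>. exp (\<theta> * X \<omega>)) \<le> expectation (\<lambda>\<omega>. 1 + \<theta> * X \<omega> + \<theta>\<^sup>2 * (X \<omega>)\<^sup>2)"
  proof (rule integral_mono_AE)
    show "AE \<omega> in M. exp (\<theta> * X \<omega>) \<le> 1 + \<theta> * X \<omega> + \<theta>\<^sup>2 * (X \<omega>)\<^sup>2"
      using bd by eventually_elim (use exp_le_quadratic[OF small] in \<open>simp add: power_mult_distrib\<close>)
  qed (use inte intX intX2 in auto)
  also have "\<dots> = 1 + \<theta>\<^sup>2 * expectation (\<lambda>\<omega>. (X \<omega>)\<^sup>2)"
    using intX intX2 mean by (simp add: prob_space)
  also have "\<dots> \<le> exp (\<theta>\<^sup>2 * expectation (\<lambda>\<omega>. (X \<omega>)\<^sup>2))"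
    by (simp add: exp_ge_add_one_self)
  finally show ?thesis .
qed

text \<open>Subtracting the compensator \<open>4 * h\<^sup>2 * K\<^sup>2 * g * (X \<omega>)\<^sup>2\<close> in the exponent cancels the second-order
  term of the expansion, because \<open>(X \<omega>)\<^sup>4 \<le> K\<^sup>2 * (X \<omega>)\<^sup>2\<close>. What remains is the mean
  \<open>h * c * expectation (\<lambda>\<omega>. (X \<omega>)\<^sup>2)\<close>, without any fourth moment. The weight \<open>g\<close>, and not just
  \<open>\<bar>c\<bar>\<close>, is admitted because coefficients of opposite sign may cancel in \<open>c\<close> while the compensator
  carries the sum of their absolute values.\<close>

lemma self_normalised_square_mgf_le:
  fixes X :: "'a \<Rightarrow> real" and K c g h :: real
  assumes [measurable]: "X \<in> borel_measurable M" and bd: "AE \<omega> in M. \<bar>X \<omega>\<bar> \<le> K"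
    and c: "\<bar>c\<bar> \<le> g" "g \<le> 1" and h: "0 \<le> h" "h * K\<^sup>2 \<le> 1 / 4"
  shows "expectation (\<lambda>\<omega>. exp ((h * c - 4 * h\<^sup>2 * K\<^sup>2 * g) * (X \<omega>)\<^sup>2))
    \<le> exp (h * c * expectation (\<lambda>\<omega>. (X \<omega>)\<^sup>2))"
proof -
  define \<alpha> where "\<alpha> = h * c - 4 * h\<^sup>2 * K\<^sup>2 * g"
  have g0: "0 \<le> g"
    using c by linarith
  have "4 * h\<^sup>2 * K\<^sup>2 * g = h * g * (4 * (h * K\<^sup>2))"
    by (simp add: power2_eq_square)
  also have "\<dots> \<le> h * g * 1"
    by (intro mult_left_mono) (use h g0 in auto)
  finally have q: "4 * h\<^sup>2 * K\<^sup>2 * g \<le> h * g"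
    by simp
  have hc: "\<bar>h * c\<bar> \<le> h * g"
    using c h by (simp add: abs_mult mult_left_mono)
  have "0 \<le> 4 * h\<^sup>2 * K\<^sup>2 * g"
    using g0 by simp
  then have a1: "\<bar>\<alpha>\<bar> \<le> 2 * h * g"
    using hc q unfolding \<alpha>_def abs_le_iff by linarith
  have small: "\<bar>\<alpha> * (X \<omega>)\<^sup>2\<bar> \<le> 1" if "(X \<omega>)\<^sup>2 \<le> K\<^sup>2" for \<omega>
  proof -
    have "\<bar>\<alpha> * (X \<omega>)\<^sup>2\<bar> \<le> (2 * h * g) * K\<^sup>2"
      unfolding abs_mult using a1 that h g0 by (intro mult_mono) auto
    also have "\<dots> = 2 * (h * K\<^sup>2) * g"
      by simp
    also have "\<dots> \<le> 2 * (1 / 4) * 1"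
      by (intro mult_mono) (use h c g0 in auto)
    finally show ?thesis
      by simp
  qed
  have X2: "AE \<omega> in M. (X \<omega>)\<^sup>2 \<le> K\<^sup>2"
    using bd by eventually_elim (simp add: abs_le_square_iff[symmetric])
  have intX2: "integrable M (\<lambda>\<omega>. (X \<omega>)\<^sup>2)"
    by (rule integrable_const_bound[of _ "K\<^sup>2"]) (use X2 in auto)
  have inte: "integrable M (\<lambda>\<omega>. exp (\<alpha> * (X \<omega>)\<^sup>2))"
  proof (rule integrable_const_bound[of _ "exp 1"])
    show "AE \<omega> in M. norm (exp (\<alpha> * (X \<omega>)\<^sup>2)) \<le> exp 1"
      using X2 by eventually_elim (use small in force)
  qed simp
  have "expectation (\<lambda>\<omega>. exp (\<alpha> * (X \<omega>)\<^sup>2)) \<le> expectation (\<lambda>\<omega>. 1 + (\<alpha> + \<alpha>\<^sup>2 * K\<^sup>2) * (X \<omega>)\<^sup>2)"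
  proof (rule integral_mono_AE)
    show "AE \<omega> in M. exp (\<alpha> * (X \<omega>)\<^sup>2) \<le> 1 + (\<alpha> + \<alpha>\<^sup>2 * K\<^sup>2) * (X \<omega>)\<^sup>2"
      using X2
    proof eventually_elim
      fix \<omega> assume X2: "(X \<omega>)\<^sup>2 \<le> K\<^sup>2"
      have "exp (\<alpha> * (X \<omega>)\<^sup>2) \<le> 1 + \<alpha> * (X \<omega>)\<^sup>2 + (\<alpha>\<^sup>2 * (X \<omega>)\<^sup>2) * (X \<omega>)\<^sup>2"
        using exp_le_quadratic[OF small[OF X2]] by (simp add: power_mult_distrib power2_eq_square mult_ac)
      also have "\<dots> \<le> 1 + \<alpha> * (X \<omega>)\<^sup>2 + (\<alpha>\<^sup>2 * K\<^sup>2) * (X \<omega>)\<^sup>2"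
        by (intro add_left_mono mult_right_mono mult_left_mono X2) auto
      finally show "exp (\<alpha> * (X \<omega>)\<^sup>2) \<le> 1 + (\<alpha> + \<alpha>\<^sup>2 * K\<^sup>2) * (X \<omega>)\<^sup>2"
        by (simp add: algebra_simps)
    qed
  qed (use inte intX2 in auto)
  also have "\<dots> = 1 + (\<alpha> + \<alpha>\<^sup>2 * K\<^sup>2) * expectation (\<lambda>\<omega>. (X \<omega>)\<^sup>2)"
    using intX2 by (simp add: prob_space)
  also have "\<dots> \<le> 1 + h * c * expectation (\<lambda>\<omega>. (X \<omega>)\<^sup>2)"
  proof (intro add_left_mono mult_right_mono)
    have "\<bar>\<alpha>\<bar> \<le> \<bar>2 * h * g\<bar>"
      using a1 by linarith
    then have "\<alpha>\<^sup>2 \<le> (2 * h * g)\<^sup>2"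
      by (simp only: abs_le_square_iff)
    also have "\<dots> = 4 * h\<^sup>2 * g * g"
      by (simp add: power2_eq_square)
    also have "\<dots> \<le> 4 * h\<^sup>2 * g * 1"
      by (intro mult_left_mono c) (use g0 in auto)
    finally have "\<alpha>\<^sup>2 * K\<^sup>2 \<le> 4 * h\<^sup>2 * g * K\<^sup>2"
      by (intro mult_right_mono) auto
    then show "\<alpha> + \<alpha>\<^sup>2 * K\<^sup>2 \<le> h * c"
      unfolding \<alpha>_def by (simp add: mult_ac)
  qed simp
  also have "\<dots> \<le> exp (h * c * expectation (\<lambda>\<omega>. (X \<omega>)\<^sup>2))"
    by (simp add: exp_ge_add_one_self)
  finally show ?thesis
    unfolding \<alpha>_def .
qed

text \<open>If the two pairs differ, some variable occurs exactly once and its mean zero annihilates the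
  product.\<close>

lemma expectation_four_factors:
  fixes X :: "'i \<Rightarrow> 'a \<Rightarrow> real"
  assumes fin: "finite I" and ind: "indep_vars (\<lambda>_. borel) X I"
    and bd: "\<And>i. i \<in> I \<Longrightarrow> AE \<omega> in M. \<bar>X i \<omega>\<bar> \<le> K"
    and mean: "\<And>i. i \<in> I \<Longrightarrow> expectation (X i) = 0"
    and I: "a \<in> I" "b \<in> I" "c \<in> I" "d \<in> I" and ne: "a \<noteq> b" "c \<noteq> d"
  shows "integrable M (\<lambda>\<omega>. X a \<omega> * X b \<omega> * (X c \<omega> * X d \<omega>))" (is ?int)
    and "expectation (\<lambda>\<omega>. X a \<omega> * X b \<omega> * (X c \<omega> * X d \<omega>)) =
      (if {a, b} = {c, d} then expectation (\<lambda>\<omega>. (X a \<omega>)\<^sup>2) * expectation (\<lambda>\<omega>. (X b \<omega>)\<^sup>2) else 0)" (is ?eq)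
proof -
  define n :: "'i \<Rightarrow> nat" where "n e = of_bool (a = e) + of_bool (b = e) + of_bool (c = e) + of_bool (d = e)" for e
  have meas[measurable]: "X i \<in> borel_measurable M" if "i \<in> I" for i
    using ind that by (auto simp: indep_vars_def)
  have single: "(\<Prod>e\<in>I. f e ^ of_bool (x = e)) = f x" if "x \<in> I" for x and f :: "'i \<Rightarrow> real"
  proof -
    have "(\<Prod>e\<in>I. f e ^ of_bool (x = e)) = (\<Prod>e\<in>I. if x = e then f e else 1)"
      by (rule prod.cong) auto
    then show ?thesis
      using that fin by (simp add: prod.delta')
  qed
  have prod: "X a \<omega> * X b \<omega> * (X c \<omega> * X d \<omega>) = (\<Prod>e\<in>I. X e \<omega> ^ n e)" for \<omega>
    unfolding n_def power_add prod.distrib by (simp only: single[OF I(1)] single[OF I(2)] single[OF I(3)] single[OF I(4)] mult.assoc)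
  have ind': "indep_vars (\<lambda>_. borel) (\<lambda>e \<omega>. X e \<omega> ^ n e) I"
    by (rule indep_vars_compose2[OF ind]) simp
  have int: "integrable M (\<lambda>\<omega>. X e \<omega> ^ n e)" if e: "e \<in> I" for e
  proof (rule integrable_const_bound[of _ "K ^ n e"])
    show "AE \<omega> in M. norm (X e \<omega> ^ n e) \<le> K ^ n e"
      using bd[OF e] by eventually_elim (simp add: power_abs power_mono)
  qed (use e in measurable)
  show ?int
    unfolding prod by (rule indep_vars_integrable[OF fin ind' int])
  have E: "expectation (\<lambda>\<omega>. X a \<omega> * X b \<omega> * (X c \<omega> * X d \<omega>)) = (\<Prod>e\<in>I. expectation (\<lambda>\<omega>. X e \<omega> ^ n e))"
    unfolding prod by (rule indep_vars_lebesgue_integral[OF fin ind' int])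
  show ?eq
  proof (cases "{a, b} = {c, d}")
    case True
    have "(\<Prod>e\<in>I. expectation (\<lambda>\<omega>. X e \<omega> ^ n e))
        = (\<Prod>e\<in>I. (if a = e then expectation (\<lambda>\<omega>. (X e \<omega>)\<^sup>2) else 1)
                  * (if b = e then expectation (\<lambda>\<omega>. (X e \<omega>)\<^sup>2) else 1))"
    proof (rule prod.cong[OF refl])
      fix e
      have "n e = (if a = e \<or> b = e then 2 else 0)"
        using True ne unfolding n_def by (auto simp: doubleton_eq_iff)
      then show "expectation (\<lambda>\<omega>. X e \<omega> ^ n e) = (if a = e then expectation (\<lambda>\<omega>. (X e \<omega>)\<^sup>2) else 1)
                  * (if b = e then expectation (\<lambda>\<omega>. (X e \<omega>)\<^sup>2) else 1)"
        using ne by (auto simp: prob_space)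
    qed
    also have "\<dots> = expectation (\<lambda>\<omega>. (X a \<omega>)\<^sup>2) * expectation (\<lambda>\<omega>. (X b \<omega>)\<^sup>2)"
      unfolding prod.distrib using I fin by (simp add: prod.delta')
    finally show ?thesis
      using True E by simp
  next
    case False
    then have "a \<notin> {c, d} \<or> b \<notin> {c, d}"
      using ne by (auto simp: doubleton_eq_iff)
    then obtain e where e: "e \<in> I" "n e = 1"
      using I ne unfolding n_def by (smt (verit) insertCI of_bool_eq(1) of_bool_eq(2) add.right_neutral add.left_neutral)
    then have "(\<Prod>e\<in>I. expectation (\<lambda>\<omega>. X e \<omega> ^ n e)) = 0"
      using fin mean[OF e(1)] by (intro prod_zero) (auto intro!: bexI[of _ e])
    then show ?thesis
      using False E by simp
  qed
qed

text \<open>The products for two different pairs are orthogonal unless one pair is the reversal of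
  the other. Hence only the
  diagonal and the transposed coefficients survive, and the mean inequality bounds the latter
  by the former, which accounts for the factor 2.\<close>

lemma second_moment_off_diagonal:
  fixes X :: "'i \<Rightarrow> 'a \<Rightarrow> real"
  assumes fin: "finite I" and ind: "indep_vars (\<lambda>_. borel) X I"
    and bd: "\<And>i. i \<in> I \<Longrightarrow> AE \<omega> in M. \<bar>X i \<omega>\<bar> \<le> K"
    and mean: "\<And>i. i \<in> I \<Longrightarrow> expectation (X i) = 0"
    and Z: "Z \<subseteq> {(a, b). a \<in> I \<and> b \<in> I \<and> a \<noteq> b}"
  defines "s \<equiv> \<lambda>i. expectation (\<lambda>\<omega>. (X i \<omega>)\<^sup>2)"
  shows "integrable M (\<lambda>\<omega>. (\<Sum>(a, b)\<in>Z. q (a, b) * (X a \<omega> * X b \<omega>))\<^sup>2)" (is ?int)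
    and "expectation (\<lambda>\<omega>. (\<Sum>(a, b)\<in>Z. q (a, b) * (X a \<omega> * X b \<omega>))\<^sup>2)
      \<le> 2 * (\<Sum>(a, b)\<in>Z. (q (a, b))\<^sup>2 * (s a * s b))" (is ?le)
proof -
  have finZ: "finite Z"
    by (rule finite_subset[of _ "I \<times> I"]) (use Z fin in auto)
  define T where "T z z' = (if {fst z, snd z} = {fst z', snd z'} then s (fst z) * s (snd z) else 0)"
    for z z' :: "'i \<times> 'i"
  define P where "P z \<omega> = X (fst z) \<omega> * X (snd z) \<omega>" for z \<omega>
  have sum: "(\<Sum>(a, b)\<in>Z. q (a, b) * (X a \<omega> * X b \<omega>)) = (\<Sum>z\<in>Z. q z * P z \<omega>)" for \<omega>
    by (rule sum.cong) (auto simp: P_def)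
  have sq: "(\<Sum>(a, b)\<in>Z. q (a, b) * (X a \<omega> * X b \<omega>))\<^sup>2 = (\<Sum>z\<in>Z. \<Sum>z'\<in>Z. q z * q z' * (P z \<omega> * P z' \<omega>))" for \<omega>
    unfolding sum power2_eq_square sum_product by (simp add: mult_ac)
  have four: "integrable M (\<lambda>\<omega>. P z \<omega> * P z' \<omega>)" "expectation (\<lambda>\<omega>. P z \<omega> * P z' \<omega>) = T z z'"
    if "z \<in> Z" "z' \<in> Z" for z z'
  proof -
    have "fst z \<in> I" "snd z \<in> I" "fst z' \<in> I" "snd z' \<in> I" "fst z \<noteq> snd z" "fst z' \<noteq> snd z'"
      using that Z by auto
    note ff = expectation_four_factors[OF fin ind bd mean this]
    show "integrable M (\<lambda>\<omega>. P z \<omega> * P z' \<omega>)"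
      unfolding P_def by (rule ff(1))
    show "expectation (\<lambda>\<omega>. P z \<omega> * P z' \<omega>) = T z z'"
      unfolding P_def T_def s_def by (rule ff(2))
  qed
  show ?int
    unfolding sq using four by (intro Bochner_Integration.integrable_sum) auto
  have s0: "0 \<le> s i" for i
    by (simp add: s_def)
  have T0: "0 \<le> T z z'" for z z'
    by (simp add: T_def s0)
  have Tsym: "T z z' = T z' z" for z z'
    by (cases z; cases z') (auto simp: T_def doubleton_eq_iff)
  have Trow: "(\<Sum>z'\<in>Z. T z z') \<le> 2 * (s (fst z) * s (snd z))" for z
  proof -
    have "(\<Sum>z'\<in>Z. T z z') = (\<Sum>z'\<in>Z \<inter> {z, (snd z, fst z)}. s (fst z) * s (snd z))"
      unfolding T_def by (subst sum.inter_restrict[OF finZ], rule sum.cong)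
        (auto simp: doubleton_eq_iff)
    also have "\<dots> = real (card (Z \<inter> {z, (snd z, fst z)})) * (s (fst z) * s (snd z))"
      by simp
    also have "\<dots> \<le> 2 * (s (fst z) * s (snd z))"
    proof (rule mult_right_mono)
      have "card (Z \<inter> {z, (snd z, fst z)}) \<le> card {z, (snd z, fst z)}"
        by (intro card_mono) auto
      also have "\<dots> \<le> 2"
        by (simp add: card_insert_if)
      finally show "real (card (Z \<inter> {z, (snd z, fst z)})) \<le> 2"
        by simp
    qed (simp add: s0)
    finally show ?thesis .
  qed
  have "expectation (\<lambda>\<omega>. (\<Sum>(a, b)\<in>Z. q (a, b) * (X a \<omega> * X b \<omega>))\<^sup>2) = (\<Sum>z\<in>Z. \<Sum>z'\<in>Z. q z * q z' * T z z')"
    unfolding sq using four by (simp add: integrable_sum)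
  also have "\<dots> \<le> (\<Sum>z\<in>Z. \<Sum>z'\<in>Z. ((q z)\<^sup>2 / 2 + (q z')\<^sup>2 / 2) * T z z')"
  proof (intro sum_mono mult_right_mono T0)
    fix z z'
    show "q z * q z' \<le> (q z)\<^sup>2 / 2 + (q z')\<^sup>2 / 2"
      using zero_le_power2[of "q z - q z'"] by (simp add: power2_diff)
  qed
  also have "\<dots> = (\<Sum>z\<in>Z. \<Sum>z'\<in>Z. (q z)\<^sup>2 / 2 * T z z') + (\<Sum>z\<in>Z. \<Sum>z'\<in>Z. (q z')\<^sup>2 / 2 * T z z')"
    by (simp add: distrib_right sum.distrib)
  also have "(\<Sum>z\<in>Z. \<Sum>z'\<in>Z. (q z')\<^sup>2 / 2 * T z z') = (\<Sum>z\<in>Z. \<Sum>z'\<in>Z. (q z)\<^sup>2 / 2 * T z z')"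
    by (subst sum.swap) (simp add: Tsym)
  also have "(\<Sum>z\<in>Z. \<Sum>z'\<in>Z. (q z)\<^sup>2 / 2 * T z z') + (\<Sum>z\<in>Z. \<Sum>z'\<in>Z. (q z)\<^sup>2 / 2 * T z z')
      = (\<Sum>z\<in>Z. (q z)\<^sup>2 * (\<Sum>z'\<in>Z. T z z'))"
    by (simp add: sum.distrib[symmetric] sum_distrib_left) (simp add: mult.commute)
  also have "\<dots> \<le> (\<Sum>z\<in>Z. (q z)\<^sup>2 * (2 * (s (fst z) * s (snd z))))"
    by (intro sum_mono mult_left_mono Trow) auto
  also have "\<dots> = 2 * (\<Sum>(a, b)\<in>Z. (q (a, b))\<^sup>2 * (s a * s b))"
    by (simp add: sum_distrib_left case_prod_unfold mult_ac)
  finally show ?le .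
qed

end

section \<open>Tail bounds for bounded symmetric random matrices\<close>

lemma sum_matrix_upper_triangle:
  fixes f :: "'n::{finite,linorder} \<Rightarrow> 'n \<Rightarrow> real"
  shows "(\<Sum>i\<in>UNIV. \<Sum>j\<in>UNIV. f i j)
    = (\<Sum>(i, j)\<in>{(i, j). i \<le> j}. if i = j then f i j else f i j + f j i)"
proof -
  let ?D = "{(i, j). i = j} :: ('n \<times> 'n) set" and ?U = "{(i, j). i < j} :: ('n \<times> 'n) set"
    and ?L = "{(i, j). j < i} :: ('n \<times> 'n) set"
  have "(\<Sum>i\<in>UNIV. \<Sum>j\<in>UNIV. f i j) = (\<Sum>(i, j)\<in>UNIV. f i j)"
    by (simp add: sum.cartesian_product)
  also have "UNIV = (?D \<union> ?U) \<union> ?L"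
    by auto
  also have "(\<Sum>(i, j)\<in>(?D \<union> ?U) \<union> ?L. f i j)
      = (\<Sum>(i, j)\<in>?D. f i j) + (\<Sum>(i, j)\<in>?U. f i j) + (\<Sum>(i, j)\<in>?L. f i j)"
    by (subst sum.union_disjoint; (subst sum.union_disjoint)?; auto)
  also have "(\<Sum>(i, j)\<in>?L. f i j) = (\<Sum>(i, j)\<in>?U. f j i)"
    by (rule sum.reindex_bij_witness[of _ prod.swap prod.swap]) auto
  finally have 1: "(\<Sum>i\<in>UNIV. \<Sum>j\<in>UNIV. f i j)
      = (\<Sum>(i, j)\<in>?D. f i j) + (\<Sum>(i, j)\<in>?U. f i j + f j i)"
    by (simp add: case_prod_unfold sum.distrib)
  have "{(i, j). i \<le> j} = ?D \<union> ?U"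
    by auto
  then have "(\<Sum>(i, j)\<in>{(i, j). i \<le> j}. if i = j then f i j else f i j + f j i)
      = (\<Sum>(i, j)\<in>?D. if i = j then f i j else f i j + f j i)
      + (\<Sum>(i, j)\<in>?U. if i = j then f i j else f i j + f j i)"
    by (simp add: sum.union_disjoint disjoint_iff)
  also have "(\<Sum>(i, j)\<in>?D. if i = j then f i j else f i j + f j i) = (\<Sum>(i, j)\<in>?D. f i j)"
    by (rule sum.cong) auto
  also have "(\<Sum>(i, j)\<in>?U. if i = j then f i j else f i j + f j i) = (\<Sum>(i, j)\<in>?U. f i j + f j i)"
    by (rule sum.cong) auto
  finally show ?thesis
    using 1 by simp
qed

lemma norm_vec_sum_squares: "(norm x)\<^sup>2 = (\<Sum>i\<in>UNIV. (x $ i)\<^sup>2)" for x :: "real ^ 'n"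
  unfolding power2_norm_eq_inner inner_vec_def by (simp add: power2_eq_square)

lemma inner_matrix_vector_sum:
  "x \<bullet> (B *v y) = (\<Sum>i\<in>UNIV. \<Sum>j\<in>UNIV. x $ i * y $ j * B $ i $ j)" for B :: "real ^ 'n ^ 'n"
  by (simp add: inner_vec_def matrix_vector_mult_def sum_distrib_left mult_ac)

locale bounded_symmetric_matrix = prob_space M
  for M :: "'w measure" +
  fixes K \<sigma> :: real and E :: "'w \<Rightarrow> real ^ 'n::{finite,linorder} ^ 'n::{finite,linorder}"
  assumes ensemble: "bounded_random_matrix M K \<sigma> E"
begin

definition xi :: "'n \<times> 'n \<Rightarrow> 'w \<Rightarrow> real" where
  "xi = (\<lambda>(i, j) \<omega>. E \<omega> $ i $ j)"

abbreviation Up :: "('n \<times> 'n) set" where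
  "Up \<equiv> {(i, j). i \<le> j}"

abbreviation edge :: "'n \<Rightarrow> 'n \<Rightarrow> 'n \<times> 'n" where
  "edge i j \<equiv> (min i j, max i j)"

lemma xi_indep: "indep_vars (\<lambda>_. borel) xi Up"
  using ensemble by (simp add: bounded_random_matrix_def xi_def)

lemma xi_measurable: "a \<in> Up \<Longrightarrow> xi a \<in> borel_measurable M"
  using xi_indep by (auto simp: indep_vars_def)

lemma xi_mean: "a \<in> Up \<Longrightarrow> expectation (xi a) = 0"
  using ensemble by (auto simp: bounded_random_matrix_def xi_def)

lemma xi_bounded: "a \<in> Up \<Longrightarrow> AE \<omega> in M. \<bar>xi a \<omega>\<bar> \<le> K"
  using ensemble unfolding bounded_random_matrix_def xi_def
  by (auto elim!: eventually_mono)

lemma entry_symmetric: "\<omega> \<in> space M \<Longrightarrow> E \<omega> $ i $ j = E \<omega> $ j $ i"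
  using ensemble unfolding bounded_random_matrix_def transpose_def
  by (metis (no_types, lifting) vec_lambda_beta)

lemma entry_eq_xi: "\<omega> \<in> space M \<Longrightarrow> E \<omega> $ i $ j = xi (edge i j) \<omega>"
  using entry_symmetric by (simp add: xi_def min_def max_def)

lemma edge_Up: "edge i j \<in> Up"
  by (auto intro: order_trans[of _ i])

lemma entry_measurable [measurable]: "(\<lambda>\<omega>. E \<omega> $ i $ j) \<in> borel_measurable M"
  using xi_measurable[OF edge_Up, of i j] by (simp cong: measurable_cong add: entry_eq_xi)

lemma entry_variance_eq_edge:
  "entry_variance M E i j = expectation (\<lambda>\<omega>. (xi (edge i j) \<omega>)\<^sup>2)"
proof -
  have "expectation (\<lambda>\<omega>. E \<omega> $ i $ j) = expectation (xi (edge i j))"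
    by (rule Bochner_Integration.integral_cong) (simp_all add: entry_eq_xi)
  then have "expectation (\<lambda>\<omega>. E \<omega> $ i $ j) = 0"
    using xi_mean[OF edge_Up] by simp
  then show ?thesis
    unfolding entry_variance_def
    by (intro Bochner_Integration.integral_cong) (simp_all add: entry_eq_xi)
qed

lemma entry_variance_symmetric: "entry_variance M E i j = entry_variance M E j i"
  by (simp add: entry_variance_eq_edge min.commute max.commute)

lemma entry_variance_nonneg: "0 \<le> entry_variance M E i j"
  by (simp add: entry_variance_eq_edge)

lemma entry_variance_le: "entry_variance M E i j \<le> \<sigma>\<^sup>2"
proof -
  have "entry_variance M E (min i j) (max i j) \<le> \<sigma>\<^sup>2"
    using ensemble edge_Up[of i j] unfolding bounded_random_matrix_def by blast
  then show ?thesis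
    using entry_variance_symmetric[of i j] by (cases "i \<le> j") (auto simp: min_def max_def)
qed

lemma bound_nonneg: "0 \<le> K"
proof -
  have "AE \<omega> in M. 0 \<le> K"
    using xi_bounded[OF edge_Up] by eventually_elim linarith
  then show ?thesis
    by simp
qed

text \<open>Written over the independent entries on and above the diagonal, the form has coefficients of
  absolute value at most 1 whose squares add up to at most 2. The exponential parameter is
  \<open>\<theta> = t / (2 * \<sigma>\<^sup>2 + K * t)\<close>, for which \<open>\<theta> * K \<le> 1\<close>. Admitting the deviation \<open>2 * t\<close> doubles the
  exponent \<open>- (t\<^sup>2 / 2) / (2 * \<sigma>\<^sup>2 + K * t)\<close>, which squares the bound; this is what makes a union
  bound affordable.\<close>

lemma bilinear_tail_upper:
  assumes x: "norm x = 1" and y: "norm y = 1" and D: "0 < 2 * \<sigma>\<^sup>2 + K * t" and t: "0 < t"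
  shows "prob {\<omega> \<in> space M. 2 * t \<le> x \<bullet> (E \<omega> *v y)} \<le> exp (- (t\<^sup>2 / (2 * \<sigma>\<^sup>2 + K * t)))"
proof -
  define D where "D = 2 * \<sigma>\<^sup>2 + K * t"
  define \<theta> where "\<theta> = t / D"
  have D0: "0 < D" and \<theta>0: "0 \<le> \<theta>"
    using D t by (simp_all add: D_def \<theta>_def)
  define c where "c = (\<lambda>(i, j). if i = j then x $ i * y $ j else x $ i * y $ j + x $ j * y $ i)"
  have form: "x \<bullet> (E \<omega> *v y) = (\<Sum>a\<in>Up. c a * xi a \<omega>)" if "\<omega> \<in> space M" for \<omega>
    unfolding inner_matrix_vector_sum sum_matrix_upper_triangle
    by (rule sum.cong) (use entry_symmetric[OF that] in \<open>auto simp: c_def xi_def algebra_simps\<close>)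
  have part: "(z $ i)\<^sup>2 + (z $ j)\<^sup>2 \<le> 1" if "norm z = 1" "i \<noteq> j" for z :: "real ^ 'n::{finite,linorder}" and i j
  proof -
    have "(\<Sum>k\<in>{i, j}. (z $ k)\<^sup>2) \<le> (\<Sum>k\<in>UNIV. (z $ k)\<^sup>2)"
      by (rule sum_mono2) auto
    then show ?thesis
      using that norm_vec_sum_squares[of z] by simp
  qed
  have coord: "\<bar>z $ i\<bar> \<le> 1" if "norm z = 1" for z :: "real ^ 'n::{finite,linorder}" and i
    using component_le_norm_cart[of z i] that by simp
  have c1: "\<bar>c a\<bar> \<le> 1" for a
  proof (cases a)
    case (Pair i j)
    show ?thesis
    proof (cases "i = j")
      case True
      then show ?thesis
        using Pair coord[OF x, of i] coord[OF y, of i] by (simp add: c_def abs_mult mult_le_one)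
    next
      case False
      have "0 \<le> (\<bar>x $ i\<bar> - \<bar>y $ j\<bar>)\<^sup>2 + (\<bar>x $ j\<bar> - \<bar>y $ i\<bar>)\<^sup>2"
        by simp
      then have "2 * (\<bar>x $ i\<bar> * \<bar>y $ j\<bar> + \<bar>x $ j\<bar> * \<bar>y $ i\<bar>) \<le> 2"
        using part[OF x False] part[OF y False] by (simp add: power2_diff)
      moreover have "\<bar>c a\<bar> \<le> \<bar>x $ i\<bar> * \<bar>y $ j\<bar> + \<bar>x $ j\<bar> * \<bar>y $ i\<bar>"
        using False Pair abs_triangle_ineq[of "x $ i * y $ j" "x $ j * y $ i"] by (simp add: c_def abs_mult)
      ultimately show ?thesis
        by simp
    qed
  qed
  have c2: "(\<Sum>a\<in>Up. (c a)\<^sup>2) \<le> 2"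
  proof -
    have "(\<Sum>a\<in>Up. (c a)\<^sup>2) \<le> (\<Sum>(i, j)\<in>Up. if i = j then 2 * (x $ i * y $ j)\<^sup>2
        else 2 * (x $ i * y $ j)\<^sup>2 + 2 * (x $ j * y $ i)\<^sup>2)"
    proof (rule sum_mono)
      fix a :: "'n \<times> 'n"
      have "(v + w)\<^sup>2 \<le> 2 * v\<^sup>2 + 2 * w\<^sup>2" for v w :: real
        using zero_le_power2[of "v - w"] by (simp add: power2_diff power2_sum)
      then show "(c a)\<^sup>2 \<le> (case a of (i, j) \<Rightarrow> if i = j then 2 * (x $ i * y $ j)\<^sup>2
          else 2 * (x $ i * y $ j)\<^sup>2 + 2 * (x $ j * y $ i)\<^sup>2)"
        by (cases a) (simp add: c_def)
    qed
    also have "\<dots> = (\<Sum>i\<in>UNIV. \<Sum>j\<in>UNIV. 2 * (x $ i * y $ j)\<^sup>2)"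
      by (rule sum_matrix_upper_triangle[symmetric])
    also have "\<dots> = 2 * ((\<Sum>i\<in>UNIV. (x $ i)\<^sup>2) * (\<Sum>j\<in>UNIV. (y $ j)\<^sup>2))"
      unfolding sum_product by (simp add: sum_distrib_left power_mult_distrib)
    also have "\<dots> = 2"
      using x y by (simp add: norm_vec_sum_squares[symmetric])
    finally show ?thesis .
  qed
  define s where "s a = expectation (\<lambda>\<omega>. (xi a \<omega>)\<^sup>2)" for a
  have s: "s a \<le> \<sigma>\<^sup>2" if "a \<in> Up" for a
    using that entry_variance_le[of "fst a" "snd a"]
    by (auto simp: s_def entry_variance_eq_edge min_def max_def)
  have small: "\<bar>\<theta> * c a\<bar> * K \<le> 1" for a
  proof -
    have "\<bar>\<theta> * c a\<bar> * K \<le> \<theta> * 1 * K"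
      unfolding abs_mult using c1 \<theta>0 bound_nonneg by (intro mult_right_mono mult_mono) auto
    also have "\<dots> \<le> 1"
      using D0 by (simp add: \<theta>_def D_def)
    finally show ?thesis .
  qed
  have "(\<Sum>a\<in>Up. (\<theta> * c a)\<^sup>2 * s a) \<le> (\<Sum>a\<in>Up. (\<theta> * c a)\<^sup>2 * \<sigma>\<^sup>2)"
    by (intro sum_mono mult_left_mono s) auto
  also have "\<dots> = \<theta>\<^sup>2 * \<sigma>\<^sup>2 * (\<Sum>a\<in>Up. (c a)\<^sup>2)"
    by (simp add: sum_distrib_left power_mult_distrib mult_ac)
  also have "\<dots> \<le> \<theta>\<^sup>2 * \<sigma>\<^sup>2 * 2"
    by (intro mult_left_mono c2) auto
  also have "\<dots> = \<theta>\<^sup>2 * (2 * \<sigma>\<^sup>2)"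
    by simp
  also have "\<dots> \<le> \<theta>\<^sup>2 * D"
    using bound_nonneg t by (intro mult_left_mono) (auto simp: D_def)
  also have "\<dots> = t\<^sup>2 / D"
    using D0 by (simp add: \<theta>_def power2_eq_square)
  finally have var: "(\<Sum>a\<in>Up. (\<theta> * c a)\<^sup>2 * s a) \<le> t\<^sup>2 / D" .
  have "prob {\<omega> \<in> space M. 2 * t \<le> x \<bullet> (E \<omega> *v y)}
      \<le> prob {\<omega> \<in> space M. (\<Sum>a\<in>Up. (\<theta> * c a)\<^sup>2 * s a) + t\<^sup>2 / D \<le> (\<Sum>a\<in>Up. \<theta> * c a * xi a \<omega>)}"
  proof (rule finite_measure_mono)
    show "{\<omega> \<in> space M. 2 * t \<le> x \<bullet> (E \<omega> *v y)}
      \<subseteq> {\<omega> \<in> space M. (\<Sum>a\<in>Up. (\<theta> * c a)\<^sup>2 * s a) + t\<^sup>2 / D \<le> (\<Sum>a\<in>Up. \<theta> * c a * xi a \<omega>)}"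
    proof safe
      fix \<omega> assume \<omega>: "\<omega> \<in> space M" "2 * t \<le> x \<bullet> (E \<omega> *v y)"
      have two: "\<theta> * (2 * t) = t\<^sup>2 / D + t\<^sup>2 / D"
        by (simp add: \<theta>_def power2_eq_square)
      have "\<theta> * (2 * t) \<le> \<theta> * (x \<bullet> (E \<omega> *v y))"
        by (intro mult_left_mono \<omega> \<theta>0)
      also have "\<dots> = (\<Sum>a\<in>Up. \<theta> * c a * xi a \<omega>)"
        by (simp add: form[OF \<omega>(1)] sum_distrib_left mult_ac)
      finally show "(\<Sum>a\<in>Up. (\<theta> * c a)\<^sup>2 * s a) + t\<^sup>2 / D \<le> (\<Sum>a\<in>Up. \<theta> * c a * xi a \<omega>)"
        using var two by linarith
    qed
    show "{\<omega> \<in> space M. (\<Sum>a\<in>Up. (\<theta> * c a)\<^sup>2 * s a) + t\<^sup>2 / D \<le> (\<Sum>a\<in>Up. \<theta> * c a * xi a \<omega>)} \<in> events"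
      using xi_measurable by measurable
  qed
  also have "\<dots> \<le> exp (- (t\<^sup>2 / D))"
  proof (rule indep_sum_exponential_tail)
    show "indep_vars (\<lambda>_. borel) (\<lambda>a \<omega>. \<theta> * c a * xi a \<omega>) Up"
      by (rule indep_vars_compose2[OF xi_indep]) simp
    show "AE \<omega> in M. \<theta> * c a * xi a \<omega> \<le> 1" if "a \<in> Up" for a
      using xi_bounded[OF that]
    proof eventually_elim
      fix \<omega> assume "\<bar>xi a \<omega>\<bar> \<le> K"
      then have "\<bar>\<theta> * c a\<bar> * \<bar>xi a \<omega>\<bar> \<le> \<bar>\<theta> * c a\<bar> * K"
        by (intro mult_left_mono) auto
      then have "\<bar>\<theta> * c a * xi a \<omega>\<bar> \<le> 1"
        unfolding abs_mult[of "\<theta> * c a"] using small[of a] by linarith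
      then show "\<theta> * c a * xi a \<omega> \<le> 1"
        by linarith
    qed
    show "expectation (\<lambda>\<omega>. exp (\<theta> * c a * xi a \<omega>)) \<le> exp ((\<theta> * c a)\<^sup>2 * s a)" if "a \<in> Up" for a
      unfolding s_def
      by (rule centred_mgf_le[OF xi_measurable[OF that] xi_bounded[OF that] xi_mean[OF that] small])
  qed simp
  finally show ?thesis
    unfolding D_def .
qed

lemma bilinear_measurable [measurable]: "(\<lambda>\<omega>. x \<bullet> (E \<omega> *v y)) \<in> borel_measurable M"
  unfolding inner_matrix_vector_sum by measurable

lemma bilinear_tail:
  assumes x: "norm x = 1" and y: "norm y = 1" and D: "0 < 2 * \<sigma>\<^sup>2 + K * t" and t: "0 < t"
  shows "prob {\<omega> \<in> space M. 2 * t \<le> \<bar>x \<bullet> (E \<omega> *v y)\<bar>} \<le> 2 * exp (- (t\<^sup>2 / (2 * \<sigma>\<^sup>2 + K * t)))"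
proof -
  have "{\<omega> \<in> space M. 2 * t \<le> \<bar>x \<bullet> (E \<omega> *v y)\<bar>}
      = {\<omega> \<in> space M. 2 * t \<le> x \<bullet> (E \<omega> *v y)} \<union> {\<omega> \<in> space M. 2 * t \<le> (- x) \<bullet> (E \<omega> *v y)}"
    by auto
  then have "prob {\<omega> \<in> space M. 2 * t \<le> \<bar>x \<bullet> (E \<omega> *v y)\<bar>}
      \<le> prob {\<omega> \<in> space M. 2 * t \<le> x \<bullet> (E \<omega> *v y)} + prob {\<omega> \<in> space M. 2 * t \<le> (- x) \<bullet> (E \<omega> *v y)}"
    by (simp only:) (intro measure_Un_le; measurable)
  then show ?thesis
    using bilinear_tail_upper[OF x y D t] bilinear_tail_upper[of "- x" y t] x y D t by simp
qed

text \<open>The fluctuation is compared with the random quantity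
  \<open>\<Sum>i\<in>UNIV. \<bar>a i\<bar> * (\<Sum>j\<in>UNIV. (E \<omega> $ i $ j)\<^sup>2)\<close>, a weighted sum of squared row norms.
  As it is bounded by the squared spectral norm, it can be controlled by a hypothesis on the outcome itself, without a
  bound on fourth moments. Any \<open>R \<ge> K\<close> may take the place of \<open>K\<close>; later \<open>R\<close> is chosen positive
  and proportional to \<open>1 / L\<close>.\<close>

lemma square_fluctuation_tail_upper:
  assumes a: "(\<Sum>i\<in>UNIV. \<bar>a i\<bar>) \<le> 1" and R: "K \<le> R" and h: "0 \<le> h" "h * R\<^sup>2 \<le> 1 / 4"
  shows "prob {\<omega> \<in> space M. 4 * h\<^sup>2 * R\<^sup>2 * (\<Sum>i\<in>UNIV. \<bar>a i\<bar> * (\<Sum>j\<in>UNIV. (E \<omega> $ i $ j)\<^sup>2)) + L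
      \<le> h * (\<Sum>i\<in>UNIV. a i * (\<Sum>j\<in>UNIV. (E \<omega> $ i $ j)\<^sup>2 - entry_variance M E i j))} \<le> exp (- L)"
proof -
  define c where "c = (\<lambda>(i, j). if i = j then a i else a i + a j)"
  define g where "g = (\<lambda>(i, j). if i = j then \<bar>a i\<bar> else \<bar>a i\<bar> + \<bar>a j\<bar>)"
  define s where "s b = expectation (\<lambda>\<omega>. (xi b \<omega>)\<^sup>2)" for b
  define \<alpha> where "\<alpha> b = h * c b - 4 * h\<^sup>2 * R\<^sup>2 * g b" for b
  have cg: "\<bar>c b\<bar> \<le> g b" for b
    by (cases b) (simp add: c_def g_def abs_triangle_ineq)
  have g1: "g b \<le> 1" for b
  proof (cases b)
    case (Pair i j)
    have "(\<Sum>k\<in>{i, j}. \<bar>a k\<bar>) \<le> (\<Sum>k\<in>UNIV. \<bar>a k\<bar>)"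
      by (rule sum_mono2) auto
    then show ?thesis
      using a Pair by (auto simp: g_def split: if_splits)
  qed
  have bd: "AE \<omega> in M. \<bar>xi b \<omega>\<bar> \<le> R" if "b \<in> Up" for b
    using xi_bounded[OF that] by eventually_elim (use R in linarith)
  have form: "(\<Sum>i\<in>UNIV. a i * (\<Sum>j\<in>UNIV. (E \<omega> $ i $ j)\<^sup>2)) = (\<Sum>b\<in>Up. c b * (xi b \<omega>)\<^sup>2)"
    and formabs: "(\<Sum>i\<in>UNIV. \<bar>a i\<bar> * (\<Sum>j\<in>UNIV. (E \<omega> $ i $ j)\<^sup>2)) = (\<Sum>b\<in>Up. g b * (xi b \<omega>)\<^sup>2)"
    if "\<omega> \<in> space M" for \<omega>
    unfolding sum_distrib_left sum_matrix_upper_triangle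
    by (rule sum.cong; use entry_symmetric[OF that] in \<open>auto simp: c_def g_def xi_def algebra_simps\<close>)+
  have mean: "(\<Sum>i\<in>UNIV. a i * (\<Sum>j\<in>UNIV. entry_variance M E i j)) = (\<Sum>b\<in>Up. c b * s b)"
    unfolding sum_distrib_left sum_matrix_upper_triangle
    by (rule sum.cong) (auto simp: c_def s_def entry_variance_eq_edge min_def max_def algebra_simps)
  have "prob {\<omega> \<in> space M. 4 * h\<^sup>2 * R\<^sup>2 * (\<Sum>i\<in>UNIV. \<bar>a i\<bar> * (\<Sum>j\<in>UNIV. (E \<omega> $ i $ j)\<^sup>2)) + L
      \<le> h * (\<Sum>i\<in>UNIV. a i * (\<Sum>j\<in>UNIV. (E \<omega> $ i $ j)\<^sup>2 - entry_variance M E i j))}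
    = prob {\<omega> \<in> space M. (\<Sum>b\<in>Up. h * c b * s b) + L \<le> (\<Sum>b\<in>Up. \<alpha> b * (xi b \<omega>)\<^sup>2)}"
  proof (rule arg_cong[where f = prob], rule Collect_cong, rule conj_cong[OF refl])
    fix \<omega> assume \<omega>: "\<omega> \<in> space M"
    have 1: "h * (\<Sum>i\<in>UNIV. a i * (\<Sum>j\<in>UNIV. (E \<omega> $ i $ j)\<^sup>2 - entry_variance M E i j))
        = h * (\<Sum>b\<in>Up. c b * (xi b \<omega>)\<^sup>2) - h * (\<Sum>b\<in>Up. c b * s b)"
      using form[OF \<omega>] mean by (simp add: sum_subtractf right_diff_distrib)
    have 2: "(\<Sum>b\<in>Up. \<alpha> b * (xi b \<omega>)\<^sup>2)
        = h * (\<Sum>b\<in>Up. c b * (xi b \<omega>)\<^sup>2) - 4 * h\<^sup>2 * R\<^sup>2 * (\<Sum>b\<in>Up. g b * (xi b \<omega>)\<^sup>2)"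
      by (simp add: \<alpha>_def left_diff_distrib sum_subtractf sum_distrib_left mult.assoc)
    have 3: "(\<Sum>b\<in>Up. h * c b * s b) = h * (\<Sum>b\<in>Up. c b * s b)"
      by (simp add: sum_distrib_left mult.assoc)
    show "(4 * h\<^sup>2 * R\<^sup>2 * (\<Sum>i\<in>UNIV. \<bar>a i\<bar> * (\<Sum>j\<in>UNIV. (E \<omega> $ i $ j)\<^sup>2)) + L
      \<le> h * (\<Sum>i\<in>UNIV. a i * (\<Sum>j\<in>UNIV. (E \<omega> $ i $ j)\<^sup>2 - entry_variance M E i j)))
      = ((\<Sum>b\<in>Up. h * c b * s b) + L \<le> (\<Sum>b\<in>Up. \<alpha> b * (xi b \<omega>)\<^sup>2))"
      unfolding 1 2 3 formabs[OF \<omega>] by linarith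
  qed
  also have "\<dots> \<le> exp (- L)"
  proof (rule indep_sum_exponential_tail)
    show "indep_vars (\<lambda>_. borel) (\<lambda>b \<omega>. \<alpha> b * (xi b \<omega>)\<^sup>2) Up"
      by (rule indep_vars_compose2[OF xi_indep]) simp
    show "AE \<omega> in M. \<alpha> b * (xi b \<omega>)\<^sup>2 \<le> \<bar>\<alpha> b\<bar> * R\<^sup>2" if "b \<in> Up" for b
      using bd[OF that]
    proof eventually_elim
      fix \<omega> assume "\<bar>xi b \<omega>\<bar> \<le> R"
      then have "(xi b \<omega>)\<^sup>2 \<le> R\<^sup>2"
        by (simp add: abs_le_square_iff[symmetric])
      then have "\<bar>\<alpha> b\<bar> * (xi b \<omega>)\<^sup>2 \<le> \<bar>\<alpha> b\<bar> * R\<^sup>2"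
        by (intro mult_left_mono) auto
      moreover have "\<alpha> b * (xi b \<omega>)\<^sup>2 \<le> \<bar>\<alpha> b\<bar> * (xi b \<omega>)\<^sup>2"
        by (intro mult_right_mono) auto
      ultimately show "\<alpha> b * (xi b \<omega>)\<^sup>2 \<le> \<bar>\<alpha> b\<bar> * R\<^sup>2"
        by linarith
    qed
    show "expectation (\<lambda>\<omega>. exp (\<alpha> b * (xi b \<omega>)\<^sup>2)) \<le> exp (h * c b * s b)" if "b \<in> Up" for b
      unfolding \<alpha>_def s_def
      by (rule self_normalised_square_mgf_le[OF xi_measurable[OF that] bd[OF that] cg g1 h])
  qed simp
  finally show ?thesis .
qed

lemma square_fluctuation_tail:
  assumes a: "(\<Sum>i\<in>UNIV. \<bar>a i\<bar>) \<le> 1" and R: "K \<le> R" and h: "0 \<le> h" "h * R\<^sup>2 \<le> 1 / 4"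
  shows "prob {\<omega> \<in> space M. 4 * h\<^sup>2 * R\<^sup>2 * (\<Sum>i\<in>UNIV. \<bar>a i\<bar> * (\<Sum>j\<in>UNIV. (E \<omega> $ i $ j)\<^sup>2)) + L
      \<le> h * \<bar>\<Sum>i\<in>UNIV. a i * (\<Sum>j\<in>UNIV. (E \<omega> $ i $ j)\<^sup>2 - entry_variance M E i j)\<bar>} \<le> 2 * exp (- L)"
    (is "prob ?B \<le> _")
proof -
  define W where "W \<omega> = 4 * h\<^sup>2 * R\<^sup>2 * (\<Sum>i\<in>UNIV. \<bar>a i\<bar> * (\<Sum>j\<in>UNIV. (E \<omega> $ i $ j)\<^sup>2)) + L" for \<omega>
  define D where "D \<omega> = (\<Sum>i\<in>UNIV. a i * (\<Sum>j\<in>UNIV. (E \<omega> $ i $ j)\<^sup>2 - entry_variance M E i j))" for \<omega>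
  have [measurable]: "W \<in> borel_measurable M" "D \<in> borel_measurable M"
    unfolding W_def D_def by measurable
  have "prob ?B \<le> prob ({\<omega> \<in> space M. W \<omega> \<le> h * D \<omega>} \<union> {\<omega> \<in> space M. W \<omega> \<le> h * (- D \<omega>)})"
    unfolding W_def[symmetric] D_def[symmetric]
    by (rule finite_measure_mono) (auto simp: abs_if split: if_splits)
  also have "\<dots> \<le> prob {\<omega> \<in> space M. W \<omega> \<le> h * D \<omega>} + prob {\<omega> \<in> space M. W \<omega> \<le> h * (- D \<omega>)}"
    by (intro measure_Un_le; measurable)
  finally have "prob ?B \<le> prob {\<omega> \<in> space M. W \<omega> \<le> h * D \<omega>} + prob {\<omega> \<in> space M. W \<omega> \<le> h * (- D \<omega>)}" .
  moreover have "prob {\<omega> \<in> space M. W \<omega> \<le> h * D \<omega>} \<le> exp (- L)"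
    unfolding W_def D_def by (rule square_fluctuation_tail_upper[OF a R h])
  moreover have "prob {\<omega> \<in> space M. W \<omega> \<le> h * (- D \<omega>)} \<le> exp (- L)"
    using square_fluctuation_tail_upper[of "\<lambda>i. - a i", OF _ R h, of L] a
    unfolding W_def D_def by (simp add: sum_negf)
  ultimately show ?thesis
    by linarith
qed

lemma row_variance_squares_le: "(\<Sum>j\<in>UNIV. (entry_variance M E i j)\<^sup>2) \<le> real CARD('n) * m4 M E"
proof -
  have "1 / real CARD('n) * (\<Sum>j\<in>UNIV. (entry_variance M E i j)\<^sup>2) \<le> m4 M E"
    unfolding m4_def by (rule Max_ge) auto
  then show ?thesis
    by (simp add: field_simps)
qed

text \<open>A path \<open>i, j, m\<close> with \<open>i \<noteq> m\<close> is determined by the ordered pair of its edges \<open>{i, j}\<close> and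
  \<open>{j, m}\<close>, since \<open>j\<close> is their only common vertex; loops are no exception. So the sum is an
  off-diagonal quadratic form in the independent entries, and Chebyshev's inequality applies.\<close>

lemma off_diagonal_tail:
  assumes x: "norm x = 1" and y: "norm y = 1" and t: "0 < t"
  shows "prob {\<omega> \<in> space M. t \<le> \<bar>\<Sum>(i, j, m)\<in>{(i, j, m). i \<noteq> m}. x $ i * y $ m * (E \<omega> $ i $ j * E \<omega> $ j $ m)\<bar>}
    \<le> 2 * real CARD('n) * m4 M E / t\<^sup>2"
proof -
  define T :: "('n \<times> 'n \<times> 'n) set" where "T = {(i, j, m). i \<noteq> m}"
  define H where "H = (\<lambda>(i, j, m). (edge i j, edge j m))"
  define Z where "Z = H ` T"
  define q where "q z = (case the_inv_into T H z of (i, j, m) \<Rightarrow> x $ i * y $ m)" for z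
  define s where "s b = expectation (\<lambda>\<omega>. (xi b \<omega>)\<^sup>2)" for b
  have edge_eq: "edge i j = edge i' j' \<longleftrightarrow> {i, j} = {i', j'}" for i j i' j' :: 'n
    by (auto simp: min_def max_def doubleton_eq_iff split: if_splits)
  have inj: "inj_on H T"
  proof (rule inj_onI)
    fix b b' assume b: "b \<in> T" "b' \<in> T" "H b = H b'"
    obtain i j m i' j' m' where [simp]: "b = (i, j, m)" "b' = (i', j', m')"
      by (metis prod_cases3)
    have "edge i j = edge i' j'" "edge j m = edge j' m'"
      using b(3) by (simp_all add: H_def)
    then have "{i, j} = {i', j'}" "{j, m} = {j', m'}"
      unfolding edge_eq .
    moreover have "i \<noteq> m" "i' \<noteq> m'"
      using b by (simp_all add: T_def)
    ultimately show "b = b'"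
      by (auto simp: doubleton_eq_iff)
  qed
  have q: "q (H t) = (case t of (i, j, m) \<Rightarrow> x $ i * y $ m)" if "t \<in> T" for t
    unfolding q_def by (simp add: the_inv_into_f_f[OF inj that])
  have ZI: "Z \<subseteq> {(a, b). a \<in> Up \<and> b \<in> Up \<and> a \<noteq> b}"
    unfolding Z_def H_def T_def by (auto simp: edge_eq min_def max_def split: if_splits)
  note moment = second_moment_off_diagonal[OF _ xi_indep xi_bounded xi_mean ZI, of q]
  have form: "(\<Sum>(i, j, m)\<in>T. x $ i * y $ m * (E \<omega> $ i $ j * E \<omega> $ j $ m))
      = (\<Sum>(a, b)\<in>Z. q (a, b) * (xi a \<omega> * xi b \<omega>))" if "\<omega> \<in> space M" for \<omega>
    unfolding Z_def sum.reindex[OF inj] o_def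
    by (rule sum.cong) (use q entry_eq_xi[OF that] in \<open>force simp: H_def\<close>)+
  have "(\<Sum>(a, b)\<in>Z. (q (a, b))\<^sup>2 * (s a * s b))
      = (\<Sum>(i, j, m)\<in>T. (x $ i * y $ m)\<^sup>2 * (entry_variance M E i j * entry_variance M E j m))"
    unfolding Z_def sum.reindex[OF inj] o_def
    by (rule sum.cong) (use q in \<open>force simp: H_def s_def entry_variance_eq_edge\<close>)+
  also have "\<dots> \<le> (\<Sum>(i, j, m)\<in>UNIV. (x $ i * y $ m)\<^sup>2 * (entry_variance M E i j * entry_variance M E j m))"
    by (rule sum_mono2) (auto simp: entry_variance_nonneg)
  also have "\<dots> \<le> (\<Sum>(i, j, m)\<in>UNIV. (x $ i * y $ m)\<^sup>2 / 2 * (entry_variance M E i j)\<^sup>2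
      + (x $ i * y $ m)\<^sup>2 / 2 * (entry_variance M E m j)\<^sup>2)"
  proof (intro sum_mono, clarify)
    fix i j m
    have "entry_variance M E i j * entry_variance M E j m
        \<le> ((entry_variance M E i j)\<^sup>2 + (entry_variance M E m j)\<^sup>2) / 2"
      using zero_le_power2[of "entry_variance M E i j - entry_variance M E j m"]
      by (simp add: power2_diff entry_variance_symmetric[of m j])
    then have "(x $ i * y $ m)\<^sup>2 * (entry_variance M E i j * entry_variance M E j m)
        \<le> (x $ i * y $ m)\<^sup>2 * (((entry_variance M E i j)\<^sup>2 + (entry_variance M E m j)\<^sup>2) / 2)"
      by (rule mult_left_mono) simp
    then show "(x $ i * y $ m)\<^sup>2 * (entry_variance M E i j * entry_variance M E j m)
        \<le> (x $ i * y $ m)\<^sup>2 / 2 * (entry_variance M E i j)\<^sup>2 + (x $ i * y $ m)\<^sup>2 / 2 * (entry_variance M E m j)\<^sup>2"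
      by (simp add: algebra_simps)
  qed
  also have "\<dots> = (\<Sum>i\<in>UNIV. \<Sum>m\<in>UNIV. \<Sum>j\<in>UNIV. (x $ i * y $ m)\<^sup>2 / 2 * (entry_variance M E i j)\<^sup>2
      + (x $ i * y $ m)\<^sup>2 / 2 * (entry_variance M E m j)\<^sup>2)"
    unfolding UNIV_Times_UNIV[symmetric] sum.cartesian_product[symmetric]
    by (rule sum.cong[OF refl], rule sum.swap)
  also have "\<dots> \<le> (\<Sum>i\<in>UNIV. \<Sum>m\<in>UNIV. (x $ i * y $ m)\<^sup>2 * (real CARD('n) * m4 M E))"
  proof (intro sum_mono)
    fix i m
    have "(\<Sum>j\<in>UNIV. (x $ i * y $ m)\<^sup>2 / 2 * (entry_variance M E i j)\<^sup>2
        + (x $ i * y $ m)\<^sup>2 / 2 * (entry_variance M E m j)\<^sup>2)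
      = (x $ i * y $ m)\<^sup>2 / 2 * ((\<Sum>j\<in>UNIV. (entry_variance M E i j)\<^sup>2) + (\<Sum>j\<in>UNIV. (entry_variance M E m j)\<^sup>2))"
      by (simp only: sum.distrib sum_distrib_left distrib_left)
    also have "\<dots> \<le> (x $ i * y $ m)\<^sup>2 / 2 * (real CARD('n) * m4 M E + real CARD('n) * m4 M E)"
      by (intro mult_left_mono add_mono row_variance_squares_le) auto
    also have "\<dots> = (x $ i * y $ m)\<^sup>2 * (real CARD('n) * m4 M E)"
      by simp
    finally show "(\<Sum>j\<in>UNIV. (x $ i * y $ m)\<^sup>2 / 2 * (entry_variance M E i j)\<^sup>2
        + (x $ i * y $ m)\<^sup>2 / 2 * (entry_variance M E m j)\<^sup>2) \<le> (x $ i * y $ m)\<^sup>2 * (real CARD('n) * m4 M E)"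
      .
  qed
  also have "\<dots> = ((\<Sum>i\<in>UNIV. (x $ i)\<^sup>2) * (\<Sum>m\<in>UNIV. (y $ m)\<^sup>2)) * (real CARD('n) * m4 M E)"
    unfolding sum_product by (simp add: sum_distrib_right power_mult_distrib)
  also have "\<dots> = real CARD('n) * m4 M E"
    using x y by (simp add: norm_vec_sum_squares[symmetric])
  finally have var: "(\<Sum>(a, b)\<in>Z. (q (a, b))\<^sup>2 * (s a * s b)) \<le> real CARD('n) * m4 M E" .
  define Y where "Y \<omega> = (\<Sum>(a, b)\<in>Z. q (a, b) * (xi a \<omega> * xi b \<omega>))" for \<omega>
  have Ymeas: "Y \<in> borel_measurable M"
    unfolding Y_def
  proof (intro borel_measurable_sum, clarify)
    fix a b c d assume "((a, b), (c, d)) \<in> Z"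
    then have "(a, b) \<in> Up" "(c, d) \<in> Up"
      using ZI by auto
    then show "(\<lambda>\<omega>. q ((a, b), (c, d)) * (xi (a, b) \<omega> * xi (c, d) \<omega>)) \<in> borel_measurable M"
      by (intro borel_measurable_times borel_measurable_const xi_measurable)
  qed
  have intY: "integrable M (\<lambda>\<omega>. (Y \<omega>)\<^sup>2)"
    unfolding Y_def by (rule moment(1)) auto
  have "expectation (\<lambda>\<omega>. (Y \<omega>)\<^sup>2) \<le> 2 * (\<Sum>(a, b)\<in>Z. (q (a, b))\<^sup>2 * (s a * s b))"
    unfolding Y_def s_def by (rule moment(2)) auto
  also have "\<dots> \<le> 2 * (real CARD('n) * m4 M E)"
    using var by simp
  finally have EY: "expectation (\<lambda>\<omega>. (Y \<omega>)\<^sup>2) \<le> 2 * real CARD('n) * m4 M E"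
    by simp
  have "{\<omega> \<in> space M. t \<le> \<bar>\<Sum>(i, j, m)\<in>T. x $ i * y $ m * (E \<omega> $ i $ j * E \<omega> $ j $ m)\<bar>}
      = {\<omega> \<in> space M. t \<le> \<bar>Y \<omega>\<bar>}"
    using form by (auto simp: Y_def)
  moreover have "prob {\<omega> \<in> space M. t \<le> \<bar>Y \<omega>\<bar>} \<le> expectation (\<lambda>\<omega>. (Y \<omega>)\<^sup>2) / t\<^sup>2"
    by (rule second_moment_method[OF Ymeas intY t])
  moreover have "expectation (\<lambda>\<omega>. (Y \<omega>)\<^sup>2) / t\<^sup>2 \<le> 2 * real CARD('n) * m4 M E / t\<^sup>2"
    by (intro divide_right_mono EY) auto
  ultimately show ?thesis
    unfolding T_def by simp
qed

end

lemma row_sum_squares_le_spectral_norm: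
  fixes B :: "real ^ 'n ^ 'n"
  assumes "transpose B = B"
  shows "(\<Sum>j\<in>UNIV. (B $ i $ j)\<^sup>2) \<le> (spectral_norm B)\<^sup>2"
proof -
  have sym: "B $ j $ i = B $ i $ j" for j
    using assms unfolding transpose_def by (metis (no_types, lifting) vec_lambda_beta)
  have "(B *v axis i 1) $ j = B $ i $ j" for j
    by (simp add: matrix_vector_mul_component inner_axis sym)
  then have "(\<Sum>j\<in>UNIV. (B $ i $ j)\<^sup>2) = (norm (B *v axis i 1))\<^sup>2"
    by (simp add: norm_vec_sum_squares)
  also have "\<dots> \<le> (spectral_norm B)\<^sup>2"
    using norm_matrix_vector_le[of B "axis i 1"] by (intro power_mono) auto
  finally show ?thesis .
qed

text \<open>For a random matrix with independent centred entries on and above the diagonal, every product in the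
  first sum has mean zero; the squares, which carry the mean of the form, are collected in the second.\<close>

lemma inner_square_decomposition:
  fixes B :: "real ^ 'n ^ 'n"
  assumes "transpose B = B"
  shows "x \<bullet> (B *v (B *v y))
    = (\<Sum>(i, j, m)\<in>{(i, j, m). i \<noteq> m}. x $ i * y $ m * (B $ i $ j * B $ j $ m))
    + (\<Sum>i\<in>UNIV. x $ i * y $ i * (\<Sum>j\<in>UNIV. (B $ i $ j)\<^sup>2))"
proof -
  have sym: "B $ j $ i = B $ i $ j" for i j
    using assms unfolding transpose_def by (metis (no_types, lifting) vec_lambda_beta)
  have "x \<bullet> (B *v (B *v y)) = (\<Sum>i\<in>UNIV. \<Sum>j\<in>UNIV. \<Sum>m\<in>UNIV. x $ i * y $ m * (B $ i $ j * B $ j $ m))"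
    by (simp add: inner_vec_def matrix_vector_mult_def sum_distrib_left mult_ac)
  also have "\<dots> = (\<Sum>(i, j, m)\<in>UNIV. x $ i * y $ m * (B $ i $ j * B $ j $ m))"
    by (simp add: sum.cartesian_product)
  also have "UNIV = {(i, j, m). i \<noteq> m} \<union> (\<lambda>(i, j). (i, j, i)) ` (UNIV :: ('n \<times> 'n) set)"
    by (auto simp: image_iff)
  also have "(\<Sum>(i, j, m)\<in>\<dots>. x $ i * y $ m * (B $ i $ j * B $ j $ m))
      = (\<Sum>(i, j, m)\<in>{(i, j, m). i \<noteq> m}. x $ i * y $ m * (B $ i $ j * B $ j $ m))
      + (\<Sum>(i, j, m)\<in>(\<lambda>(i, j). (i, j, i)) ` (UNIV :: ('n \<times> 'n) set). x $ i * y $ m * (B $ i $ j * B $ j $ m))"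
    by (rule sum.union_disjoint) auto
  also have "(\<Sum>(i, j, m)\<in>(\<lambda>(i, j). (i, j, i)) ` (UNIV :: ('n \<times> 'n) set). x $ i * y $ m * (B $ i $ j * B $ j $ m))
      = (\<Sum>(i, j)\<in>UNIV. x $ i * y $ i * (B $ i $ j)\<^sup>2)"
    by (subst sum.reindex) (auto simp: inj_on_def sym power2_eq_square case_prod_unfold intro!: sum.cong)
  also have "\<dots> = (\<Sum>i\<in>UNIV. x $ i * y $ i * (\<Sum>j\<in>UNIV. (B $ i $ j)\<^sup>2))"
    by (simp add: sum.cartesian_product[symmetric] sum_distrib_left UNIV_Times_UNIV[symmetric] del: UNIV_Times_UNIV)
  finally show ?thesis .
qed

lemma sum_abs_coordinate_products_le:
  fixes x y :: "real ^ 'n"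
  assumes "norm x = 1" "norm y = 1"
  shows "(\<Sum>i\<in>UNIV. \<bar>x $ i * y $ i\<bar>) \<le> 1"
  using L2_set_mult_ineq[of "\<lambda>i. x $ i" "\<lambda>i. y $ i" UNIV] assms
  by (simp add: abs_mult norm_vec_def L2_set_def)

context bounded_symmetric_matrix
begin

lemma inner_square_bound:
  assumes \<omega>: "\<omega> \<in> space M" and u: "orthonormal_on {1..r} u" and kl: "k \<in> {1..r}" "l \<in> {1..r}" "k \<noteq> l"
    and off: "\<bar>\<Sum>(i, j, m)\<in>{(i, j, m). i \<noteq> m}. u k $ i * u l $ m * (E \<omega> $ i $ j * E \<omega> $ j $ m)\<bar> < t2"
    and diag: "h * \<bar>\<Sum>i\<in>UNIV. u k $ i * u l $ i * (\<Sum>j\<in>UNIV. (E \<omega> $ i $ j)\<^sup>2 - entry_variance M E i j)\<bar>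
      < 4 * h\<^sup>2 * R\<^sup>2 * (\<Sum>i\<in>UNIV. \<bar>u k $ i * u l $ i\<bar> * (\<Sum>j\<in>UNIV. (E \<omega> $ i $ j)\<^sup>2)) + L"
    and h: "0 < h"
  shows "\<bar>u k \<bullet> (E \<omega> *v (E \<omega> *v u l))\<bar>
    \<le> t2 + mu M E r u + (4 * h * R\<^sup>2 * (spectral_norm (E \<omega>))\<^sup>2 + L / h)"
proof -
  define a where "a i = u k $ i * u l $ i" for i
  define D where "D = (\<Sum>i\<in>UNIV. a i * (\<Sum>j\<in>UNIV. (E \<omega> $ i $ j)\<^sup>2 - entry_variance M E i j))"
  define m where "m = (\<Sum>i\<in>UNIV. a i * (\<Sum>j\<in>UNIV. entry_variance M E j i))"
  have sym: "transpose (E \<omega>) = E \<omega>"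
    using ensemble \<omega> by (simp add: bounded_random_matrix_def)
  have a1: "(\<Sum>i\<in>UNIV. \<bar>a i\<bar>) \<le> 1"
    unfolding a_def using orthonormal_on_norm[OF u] kl by (intro sum_abs_coordinate_products_le) auto
  have "(\<Sum>i\<in>UNIV. \<bar>a i\<bar> * (\<Sum>j\<in>UNIV. (E \<omega> $ i $ j)\<^sup>2)) \<le> (\<Sum>i\<in>UNIV. \<bar>a i\<bar> * (spectral_norm (E \<omega>))\<^sup>2)"
    by (intro sum_mono mult_left_mono row_sum_squares_le_spectral_norm[OF sym]) auto
  also have "\<dots> \<le> 1 * (spectral_norm (E \<omega>))\<^sup>2"
    unfolding sum_distrib_right[symmetric] by (intro mult_right_mono a1) auto
  finally have "4 * h\<^sup>2 * R\<^sup>2 * (\<Sum>i\<in>UNIV. \<bar>a i\<bar> * (\<Sum>j\<in>UNIV. (E \<omega> $ i $ j)\<^sup>2))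
      \<le> 4 * h\<^sup>2 * R\<^sup>2 * (1 * (spectral_norm (E \<omega>))\<^sup>2)"
    by (intro mult_left_mono) auto
  then have "h * \<bar>D\<bar> \<le> h * (4 * h * R\<^sup>2 * (spectral_norm (E \<omega>))\<^sup>2 + L / h)"
    using diag h unfolding D_def a_def by (simp add: distrib_left power2_eq_square mult_ac)
  then have D: "\<bar>D\<bar> \<le> 4 * h * R\<^sup>2 * (spectral_norm (E \<omega>))\<^sup>2 + L / h"
    using h by simp
  have m: "\<bar>m\<bar> \<le> mu M E r u"
  proof -
    let ?S = "{\<bar>\<Sum>i\<in>UNIV. u k $ i * u l $ i * (\<Sum>j\<in>UNIV. entry_variance M E j i)\<bar>
       | k l. 1 \<le> k \<and> k < l \<and> l \<le> r}"
    have "?S \<subseteq> (\<lambda>(k, l). \<bar>\<Sum>i\<in>UNIV. u k $ i * u l $ i * (\<Sum>j\<in>UNIV. entry_variance M E j i)\<bar>) ` ({1..r} \<times> {1..r})"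
      by force
    then have "finite ?S"
      by (rule finite_subset) auto
    moreover have "\<bar>m\<bar> \<in> ?S"
    proof (cases "k < l")
      case True
      then show ?thesis
        unfolding m_def a_def using kl by force
    next
      case False
      then have "\<bar>m\<bar> = \<bar>\<Sum>i\<in>UNIV. u l $ i * u k $ i * (\<Sum>j\<in>UNIV. entry_variance M E j i)\<bar>"
        by (simp add: m_def a_def mult_ac)
      moreover have "1 \<le> l \<and> l < k \<and> k \<le> r"
        using False kl by auto
      ultimately show ?thesis
        by blast
    qed
    ultimately show ?thesis
      unfolding mu_def by (intro Max_ge) auto
  qed
  have "(\<Sum>i\<in>UNIV. a i * (\<Sum>j\<in>UNIV. (E \<omega> $ i $ j)\<^sup>2)) = D + m"
    unfolding D_def m_def sum.distrib[symmetric] distrib_left[symmetric]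
    by (simp add: entry_variance_symmetric sum_subtractf)
  then show ?thesis
    using off D m unfolding inner_square_decomposition[OF sym] a_def[symmetric] by linarith
qed

end

lemma mu_nonneg:
  fixes E :: "'w \<Rightarrow> real ^ 'n ^ 'n"
  shows "0 \<le> mu M E r u"
proof -
  let ?f = "\<lambda>k l. \<bar>\<Sum>i\<in>UNIV. u k $ i * u l $ i * (\<Sum>j\<in>UNIV. entry_variance M E j i)\<bar>"
  have "{?f k l | k l. 1 \<le> k \<and> k < l \<and> l \<le> r} \<subseteq> (\<lambda>(k, l). ?f k l) ` ({1..r} \<times> {1..r})"
    by force
  then have "finite {?f k l | k l. 1 \<le> k \<and> k < l \<and> l \<le> r}"
    by (rule finite_subset) auto
  then show ?thesis
    unfolding mu_def by (intro Max_ge) auto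
qed

lemma m4_nonneg:
  fixes E :: "'w \<Rightarrow> real ^ 'n ^ 'n"
  shows "0 \<le> m4 M E"
proof -
  have "0 \<le> 1 / real CARD('n) * (\<Sum>j\<in>UNIV. (entry_variance M E undefined j)\<^sup>2)"
    by (simp add: sum_nonneg)
  also have "\<dots> \<le> m4 M E"
    unfolding m4_def by (rule Max_ge) auto
  finally show ?thesis .
qed

text \<open>The choice \<open>h = (r * t1 / del) / R\<^sup>2\<close> balances the two terms of the self-normalised bound: the
  gap condition on \<open>e\<close> makes the first one at most \<open>t1 * lam / 36\<close>, and \<open>R \<le> t1 / 2\<close> makes the second
  one at most \<open>t1 * lam / 2\<close>.\<close>

lemma diagonal_part_absorbed:
  fixes e lam del t1 R :: real
  assumes lam: "0 < lam" and del: "0 < del" "del \<le> lam" and t1: "0 < t1" and r: "1 \<le> r"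
    and e2: "144 * real r * e\<^sup>2 \<le> lam * del" and R: "0 < R" "R \<le> t1 / 2"
  shows "4 * ((real r * t1 / del) / R\<^sup>2) * R\<^sup>2 * e\<^sup>2 + (t1 / R) / ((real r * t1 / del) / R\<^sup>2) \<le> t1 * lam"
proof -
  have r1: "1 \<le> real r"
    using r by simp
  have "4 * ((real r * t1 / del) / R\<^sup>2) * R\<^sup>2 * e\<^sup>2 = t1 / del / 36 * (144 * real r * e\<^sup>2)"
    using R by (simp add: field_simps)
  also have "\<dots> \<le> t1 / del / 36 * (lam * del)"
    by (intro mult_left_mono e2) (use t1 del in auto)
  also have "\<dots> = t1 * lam / 36"
    using del by simp
  finally have 1: "4 * ((real r * t1 / del) / R\<^sup>2) * R\<^sup>2 * e\<^sup>2 \<le> t1 * lam / 36" .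
  have "(t1 / R) / ((real r * t1 / del) / R\<^sup>2) = R * del / real r"
    using R t1 del r1 by (simp add: field_simps power2_eq_square)
  also have "\<dots> \<le> R * del"
    using R del r1 by (simp add: divide_le_eq)
  also have "\<dots> \<le> t1 / 2 * lam"
    by (intro mult_mono) (use R del t1 in auto)
  finally show ?thesis
    using 1 mult_pos_pos[OF t1 lam] by linarith
qed

section \<open>The perturbation bound with high probability\<close>

text \<open>The union bound. All pairs \<open>(k, l)\<close> are included for the bilinear and for the square terms, which
  contributes \<open>4 * (real r)\<^sup>2 * q\<^sup>2\<close>; because of \<open>r \<ge> 2\<close> the assumption \<open>(real r)\<^sup>2 * q \<le> 1\<close> yields
  \<open>4 * q \<le> 1\<close>. Chebyshev's inequality is used for the \<open>r * (r - 1)\<close> ordered pairs with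
  \<open>k \<noteq> l\<close>, each contributing \<open>2 * n * m4 M E / t2\<^sup>2\<close>.\<close>

lemma (in bounded_symmetric_matrix) good_event:
  assumes u: "orthonormal_on {1..r} u" and r: "2 \<le> r" and t1: "0 < t1" and t2: "0 < t2"
    and R: "R = (2 * \<sigma>\<^sup>2 + K * t1) / t1" "0 < R" and h: "0 < h" "h * R\<^sup>2 \<le> 1 / 4"
    and q: "(real r)\<^sup>2 * q \<le> 1" and q_def: "q = exp (- (t1 / (2 * R)))"
  shows "\<exists>F\<in>events.
      1 - (real r)\<^sup>2 * q - 5 * real r * (real r - 1) * real CARD('n) * m4 M E / (2 * t2\<^sup>2) \<le> prob F
    \<and> (\<forall>\<omega>\<in>F. \<omega> \<in> space M
        \<and> (\<forall>k\<in>{1..r}. \<forall>l\<in>{1..r}. \<bar>u k \<bullet> (E \<omega> *v u l)\<bar> \<le> 2 * t1)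
        \<and> (\<forall>k\<in>{1..r}. \<forall>l\<in>{1..r}. k \<noteq> l \<longrightarrow> \<bar>u k \<bullet> (E \<omega> *v (E \<omega> *v u l))\<bar>
            \<le> t2 + mu M E r u + (4 * h * R\<^sup>2 * (spectral_norm (E \<omega>))\<^sup>2 + (t1 / R) / h)))"
proof -
  define n where "n = real CARD('n)"
  define P where "P = {1..r} \<times> {1..r}"
  define P' where "P' = (SIGMA k:{1..r}. {1..r} - {k})"
  define B1 where "B1 = (\<lambda>(k, l). {\<omega> \<in> space M. 2 * t1 \<le> \<bar>u k \<bullet> (E \<omega> *v u l)\<bar>})"
  define B2 where "B2 = (\<lambda>(k, l). {\<omega> \<in> space M.
    4 * h\<^sup>2 * R\<^sup>2 * (\<Sum>i\<in>UNIV. \<bar>u k $ i * u l $ i\<bar> * (\<Sum>j\<in>UNIV. (E \<omega> $ i $ j)\<^sup>2)) + t1 / R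
      \<le> h * \<bar>\<Sum>i\<in>UNIV. u k $ i * u l $ i * (\<Sum>j\<in>UNIV. (E \<omega> $ i $ j)\<^sup>2 - entry_variance M E i j)\<bar>})"
  define B3 where "B3 = (\<lambda>(k, l). {\<omega> \<in> space M.
    t2 \<le> \<bar>\<Sum>(i, j, m)\<in>{(i, j, m). i \<noteq> m}. u k $ i * u l $ m * (E \<omega> $ i $ j * E \<omega> $ j $ m)\<bar>})"
  have nu: "norm (u k) = 1" if "k \<in> {1..r}" for k
    using orthonormal_on_norm[OF u that] .
  have D: "0 < 2 * \<sigma>\<^sup>2 + K * t1"
    using R t1 by (simp add: zero_less_divide_iff)
  have KR: "K \<le> R"
    unfolding R(1) using t1 by (simp add: field_simps)
  have q2: "exp (- (t1 / R)) = q\<^sup>2"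
    unfolding q_def by (simp add: exp_double[symmetric])
  have "t1\<^sup>2 / (2 * \<sigma>\<^sup>2 + K * t1) = t1 / R"
    unfolding R(1) by (simp add: power2_eq_square)
  then have p1: "prob (B1 z) \<le> 2 * q\<^sup>2" if "z \<in> P" for z
    using that bilinear_tail[OF nu nu D t1, of "fst z" "snd z"] q2
    by (auto simp: B1_def P_def)
  have p2: "prob (B2 z) \<le> 2 * q\<^sup>2" if "z \<in> P" for z
    using that square_fluctuation_tail[OF sum_abs_coordinate_products_le[OF nu nu] KR _ h(2),
        of "fst z" "snd z" "t1 / R"] h(1) q2
    by (auto simp: B2_def P_def)
  have p3: "prob (B3 z) \<le> 2 * n * m4 M E / t2\<^sup>2" if "z \<in> P'" for z
    using that off_diagonal_tail[OF nu nu t2, of "fst z" "snd z"]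
    by (auto simp: B3_def P'_def n_def)
  have ev: "B1 z \<in> events" "B2 z \<in> events" "B3 z \<in> events" for z
  proof -
    obtain k l where z: "z = (k, l)"
      by (metis prod.exhaust)
    show "B1 z \<in> events"
      unfolding B1_def prod.case z
      by (intro borel_measurable_le borel_measurable_const borel_measurable_abs bilinear_measurable)
    show "B2 z \<in> events"
      unfolding B2_def prod.case z
      by (intro borel_measurable_le borel_measurable_add borel_measurable_times borel_measurable_sum
          borel_measurable_diff borel_measurable_power borel_measurable_abs borel_measurable_const
          entry_measurable)
    have "(\<lambda>\<omega>. \<Sum>t\<in>{(i, j, m). i \<noteq> m}. u k $ fst t * u l $ snd (snd t)
        * (E \<omega> $ fst t $ fst (snd t) * E \<omega> $ fst (snd t) $ snd (snd t))) \<in> borel_measurable M"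
      by (intro borel_measurable_sum borel_measurable_times borel_measurable_const entry_measurable)
    then have "(\<lambda>\<omega>. \<Sum>(i, j, m)\<in>{(i, j, m). i \<noteq> m}. u k $ i * u l $ m * (E \<omega> $ i $ j * E \<omega> $ j $ m)) \<in> borel_measurable M"
      by (simp add: case_prod_unfold)
    then show "B3 z \<in> events"
      unfolding B3_def prod.case z by (intro borel_measurable_le borel_measurable_const borel_measurable_abs)
  qed
  define Bad where "Bad = (\<Union>z\<in>P. B1 z) \<union> (\<Union>z\<in>P. B2 z) \<union> (\<Union>z\<in>P'. B3 z)"
  have fin: "finite P" "finite P'"
    by (simp_all add: P_def P'_def)
  have evU: "(\<Union>z\<in>P. B1 z) \<in> events" "(\<Union>z\<in>P. B2 z) \<in> events" "(\<Union>z\<in>P'. B3 z) \<in> events"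
    using ev fin by auto
  then have evB: "Bad \<in> events"
    by (simp add: Bad_def)
  have cP: "real (card P) = (real r)\<^sup>2" "real (card P') = real r * (real r - 1)"
    using r by (simp_all add: P_def P'_def power2_eq_square of_nat_diff)
  have U: "prob (\<Union>z\<in>Q. B z) \<le> real (card Q) * b"
    if "finite Q" "\<And>z. B z \<in> events" "\<And>z. z \<in> Q \<Longrightarrow> prob (B z) \<le> b"
    for Q :: "(nat \<times> nat) set" and B b
  proof -
    have "prob (\<Union>z\<in>Q. B z) \<le> (\<Sum>z\<in>Q. prob (B z))"
      by (rule finite_measure_subadditive_finite) (use that in auto)
    also have "\<dots> \<le> real (card Q) * b"
      using sum_bounded_above[of Q "\<lambda>z. prob (B z)" b] that by simp
    finally show ?thesis .
  qed
  have "prob Bad \<le> prob (\<Union>z\<in>P. B1 z) + prob (\<Union>z\<in>P. B2 z) + prob (\<Union>z\<in>P'. B3 z)"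
    unfolding Bad_def using measure_Un_le[of "(\<Union>z\<in>P. B1 z) \<union> (\<Union>z\<in>P. B2 z)" M "\<Union>z\<in>P'. B3 z"]
      measure_Un_le[of "\<Union>z\<in>P. B1 z" M "\<Union>z\<in>P. B2 z"] evU by auto
  also have "\<dots> \<le> (real r)\<^sup>2 * (2 * q\<^sup>2) + (real r)\<^sup>2 * (2 * q\<^sup>2) + real r * (real r - 1) * (2 * n * m4 M E / t2\<^sup>2)"
    unfolding cP[symmetric] by (intro add_mono U fin ev p1 p2 p3)
  finally have bad: "prob Bad \<le> (real r)\<^sup>2 * (2 * q\<^sup>2) + (real r)\<^sup>2 * (2 * q\<^sup>2)
      + real r * (real r - 1) * (2 * n * m4 M E / t2\<^sup>2)" .
  have q0: "0 < q"
    by (simp add: q_def)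
  have "4 * q \<le> (real r)\<^sup>2 * q"
    using r q0 power_mono[of 2 "real r" 2] by (intro mult_right_mono) auto
  then have "4 * q \<le> 1"
    using q by linarith
  then have "(real r)\<^sup>2 * q * (4 * q) \<le> (real r)\<^sup>2 * q * 1"
    using q0 by (intro mult_left_mono) auto
  then have "(real r)\<^sup>2 * (2 * q\<^sup>2) + (real r)\<^sup>2 * (2 * q\<^sup>2) \<le> (real r)\<^sup>2 * q"
    by (simp add: power2_eq_square algebra_simps)
  moreover have "real r * (real r - 1) * (2 * n * m4 M E / t2\<^sup>2) \<le> 5 * real r * (real r - 1) * n * m4 M E / (2 * t2\<^sup>2)"
  proof -
    define c where "c = real r * (real r - 1) * (n * m4 M E / t2\<^sup>2)"
    have "0 \<le> c"
      using r m4_nonneg[of M E] by (simp add: c_def n_def)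
    moreover have "real r * (real r - 1) * (2 * n * m4 M E / t2\<^sup>2) = 2 * c"
      "5 * real r * (real r - 1) * n * m4 M E / (2 * t2\<^sup>2) = 5 / 2 * c"
      by (simp_all add: c_def)
    ultimately show ?thesis
      by linarith
  qed
  ultimately have bad': "prob Bad \<le> (real r)\<^sup>2 * q + 5 * real r * (real r - 1) * n * m4 M E / (2 * t2\<^sup>2)"
    using bad by linarith
  show ?thesis
  proof (intro bexI[of _ "space M - Bad"] conjI ballI impI)
    show "1 - (real r)\<^sup>2 * q - 5 * real r * (real r - 1) * real CARD('n) * m4 M E / (2 * t2\<^sup>2) \<le> prob (space M - Bad)"
      using bad' prob_compl[OF evB] by (simp add: n_def)
  next
    fix \<omega> k l assume \<omega>: "\<omega> \<in> space M - Bad" and k: "k \<in> {1..r}" and l: "l \<in> {1..r}"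
    then have "\<omega> \<notin> B1 (k, l)"
      by (auto simp: Bad_def P_def)
    then show "\<bar>u k \<bullet> (E \<omega> *v u l)\<bar> \<le> 2 * t1"
      using \<omega> by (simp add: B1_def)
    assume kl: "k \<noteq> l"
    have "\<omega> \<notin> B2 (k, l)" "\<omega> \<notin> B3 (k, l)"
      using \<omega> k l kl by (auto simp: Bad_def P_def P'_def)
    then show "\<bar>u k \<bullet> (E \<omega> *v (E \<omega> *v u l))\<bar>
        \<le> t2 + mu M E r u + (4 * h * R\<^sup>2 * (spectral_norm (E \<omega>))\<^sup>2 + (t1 / R) / h)"
      using \<omega> unfolding B2_def B3_def
      by (intro inner_square_bound[OF _ u k l kl _ _ h(1)]) (simp_all add: not_le)
  qed (use evB in auto)
qed

theorem theorem5p3: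
  fixes M :: "'w measure"
    and A Pi_p :: "real ^ 'n::{finite,linorder} ^ 'n::{finite,linorder}"
    and E :: "'w \<Rightarrow> real ^ 'n::{finite,linorder} ^ 'n::{finite,linorder}"
    and K \<sigma> t1 t2 \<delta> :: real
    and r p :: nat
    and lam :: "nat \<Rightarrow> real"
    and u :: "nat \<Rightarrow> real ^ 'n::{finite,linorder}"
  assumes "prob_space M"
    and "transpose A = A"
    and "rank A = r" and "r < CARD('n)"
    and "bounded_random_matrix M K \<sigma> E"
    and "sorted_eigenvalues A lam"
    and "nonzero_eigenvectors A r u"
    and "1 \<le> p" and "p < CARD('n)"
    and "lam p > 0"
    and "\<delta> = lam p - lam (p + 1)" and "\<delta> > 0"
    and "top_eigenprojection p A Pi_p"
    and "t1 > 0" and "t2 > 0"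
  shows "with_prob_at_least M
    (1 - (real r)\<^sup>2 * exp ((- t1\<^sup>2 / 2) / (2 * \<sigma>\<^sup>2 + K * t1))
       - 5 * real r * (real r - 1) * real CARD('n) * m4 M E / (2 * t2\<^sup>2))
    (\<lambda>\<omega>. \<delta> \<ge> max (12 * real r * t1) (144 * real r * (spectral_norm (E \<omega>))\<^sup>2 / \<bar>lam p\<bar>) \<longrightarrow>
      (\<forall>Pi_tilde. top_eigenprojection p (A + E \<omega>) Pi_tilde \<longrightarrow>
        (let \<epsilon>1 = spectral_norm (E \<omega>) / \<bar>lam p\<bar>;
             \<epsilon>2 = 1 / \<delta>
         in spectral_norm (Pi_tilde - Pi_p) \<le>
              12 * sqrt (real p) *
                (\<epsilon>1 + sqrt (real r) * t1 * \<epsilon>2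
                   + sqrt (real r) * (t2 + mu M E r u) / spectral_norm (E \<omega>) * \<epsilon>1 * \<epsilon>2))))"
    (is "with_prob_at_least M ?prob ?Q")
proof -
  note sym = assms(2) and rank = assms(3) and rn = assms(4) and ens = assms(5) and ne = assms(7)
    and p = assms(8,9) and pos = assms(10) and del_def = assms(11) and del = assms(12)
    and t1 = assms(14) and t2 = assms(15)
  interpret prob_space M
    by (rule assms(1))
  interpret bounded_symmetric_matrix M K \<sigma> E
    by unfold_locales (rule ens)
  obtain v0 where v0: "sorted_eigensystem A lam v0"
    using assms(6) by (auto simp: sorted_eigenvalues_def)
  obtain lam' v where v: "sorted_eigensystem A lam' v"
    and Pi: "orthogonal_projection_onto Pi_p (span (v ` {1..p}))"
    using assms(13) by (auto simp: top_eigenprojection_def)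
  have lam': "lam' p = lam p" "lam' (p + 1) = lam (p + 1)"
    using p by (auto intro!: antisym sorted_eigensystem_le[OF v v0] sorted_eigensystem_le[OF v0 v])
  define I where "I = {1..r}"
  have u: "orthonormal_on I u" and fin: "finite I" and cI: "card I = r"
    using ne by (simp_all add: nonzero_eigenvectors_def I_def)
  obtain \<mu> where Au: "\<And>k. k \<in> I \<Longrightarrow> A *v u k = \<mu> k *\<^sub>R u k"
    using ne unfolding nonzero_eigenvectors_def I_def by metis
  define J where "J = {k \<in> I. lam p \<le> \<mu> k}"
  have gap': "lam' (p + 1) < lam' p" and pos': "0 < lam' p"
    using del del_def pos lam' by auto
  note top = top_eigenspace_in_nonzero_eigenvectors[OF sym rank ne v p pos' gap' Au[unfolded I_def],
      unfolded lam', folded I_def, folded J_def]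
  have cJ: "card J = p" and spanJ: "span (v ` {1..p}) = span (u ` J)"
    and lo: "\<And>k. k \<in> I - J \<Longrightarrow> \<mu> k \<le> lam p - \<delta>"
    using top del_def by auto
  have JI: "J \<subseteq> I" and finJ: "finite J" and hi: "\<And>k. k \<in> J \<Longrightarrow> lam p \<le> \<mu> k"
    using fin by (auto simp: J_def)
  have A0: "A *v z = 0" if "\<And>k. k \<in> I \<Longrightarrow> u k \<bullet> z = 0" for z
    by (rule nonzero_eigenvectors_orthogonal_kernel[OF sym rank ne]) (use that in \<open>simp add: I_def\<close>)
  have pr: "p \<le> r"
    using card_mono[OF fin JI] cJ cI by simp
  then have r1: "1 \<le> r" and rr: "1 \<le> real r"
    using p by simp_all
  have dl: "\<delta> \<le> lam p"
    using eigenvalue_after_gap_nonneg[OF v p pos'] rank rn lam' del_def by simp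
  note uJ = orthonormal_on_subset[OF u JI]
  have Pi_p: "Pi_p *v z = onproj u J z" for z
    using orthogonal_projection_onto_span[OF uJ finJ] Pi spanJ by simp
  have det: "spectral_norm (Pt - Pi_p) \<le> 4 * sqrt (real p) *
      (spectral_norm (E \<omega>) / lam p + sqrt (real r) * x / del' + sqrt (real r) * y / (lam p * del'))"
    if \<omega>: "\<omega> \<in> space M" and Pt: "top_eigenprojection p (A + E \<omega>) Pt"
      and del': "0 < del'" "del' \<le> lam p" "\<And>k. k \<in> I - J \<Longrightarrow> \<mu> k \<le> lam p - del'"
      and x: "\<And>k l. k \<in> I \<Longrightarrow> l \<in> I \<Longrightarrow> \<bar>u k \<bullet> (E \<omega> *v u l)\<bar> \<le> x" "0 \<le> x"
      and y: "\<And>k l. k \<in> I - J \<Longrightarrow> l \<in> J \<Longrightarrow> \<bar>u k \<bullet> (E \<omega> *v (E \<omega> *v u l))\<bar> \<le> y" "0 \<le> y"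
      and small: "real r * x \<le> del' / 6" "144 * (spectral_norm (E \<omega>))\<^sup>2 \<le> lam p * del'"
    for \<omega> Pt del' x y
  proof (rule spectral_norm_le)
    fix z
    obtain nu w where w: "sorted_eigensystem (A + E \<omega>) nu w"
      and Ptw: "orthogonal_projection_onto Pt (span (w ` {1..p}))"
      using Pt by (auto simp: top_eigenprojection_def)
    have "orthonormal_on {1..p} w"
      using w p by (auto simp: sorted_eigensystem_def elim!: orthonormal_on_subset)
    then have "Pt *v z = onproj w {1..p} z"
      by (rule orthogonal_projection_onto_span) (use Ptw in auto)
    then have "(Pt - Pi_p) *v z = onproj w {1..p} z - onproj u J z"
      by (simp add: matrix_vector_mult_diff_rdistrib Pi_p)
    then show "norm ((Pt - Pi_p) *v z) \<le> 4 * sqrt (real p) *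
      (spectral_norm (E \<omega>) / lam p + sqrt (real r) * x / del' + sqrt (real r) * y / (lam p * del')) * norm z"
      using perturbed_projection_estimate[OF u fin cI JI cJ p(1) less_imp_le[OF p(2)] Au A0 hi del'(3)
          del'(1,2) x y small w] by simp
  qed
  have entry_le: "\<bar>u k \<bullet> (E \<omega> *v u l)\<bar> \<le> spectral_norm (E \<omega>)"
    and entry2_le: "\<bar>u k \<bullet> (E \<omega> *v (E \<omega> *v u l))\<bar> \<le> (spectral_norm (E \<omega>))\<^sup>2" if "k \<in> I" "l \<in> I" for \<omega> k l
  proof -
    have nk: "norm (u k) = 1" "norm (u l) = 1"
      using orthonormal_on_norm[OF u] that by auto
    have 1: "norm (E \<omega> *v u l) \<le> spectral_norm (E \<omega>)"
      using norm_matrix_vector_le[of "E \<omega>" "u l"] nk by simp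
    then show "\<bar>u k \<bullet> (E \<omega> *v u l)\<bar> \<le> spectral_norm (E \<omega>)"
      using Cauchy_Schwarz_ineq2[of "u k" "E \<omega> *v u l"] nk by simp
    have "norm (E \<omega> *v (E \<omega> *v u l)) \<le> spectral_norm (E \<omega>) * spectral_norm (E \<omega>)"
      using norm_matrix_vector_le[of "E \<omega>" "E \<omega> *v u l"]
        mult_left_mono[OF 1 spectral_norm_nonneg[of "E \<omega>"]] by linarith
    then show "\<bar>u k \<bullet> (E \<omega> *v (E \<omega> *v u l))\<bar> \<le> (spectral_norm (E \<omega>))\<^sup>2"
      using Cauchy_Schwarz_ineq2[of "u k" "E \<omega> *v (E \<omega> *v u l)"] nk by (simp add: power2_eq_square)
  qed
  define y0 where "y0 = t2 + mu M E r u"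
  have y0: "0 \<le> y0"
    using t2 mu_nonneg[of M E r u] by (simp add: y0_def)
  define q where "q = exp ((- t1\<^sup>2 / 2) / (2 * \<sigma>\<^sup>2 + K * t1))"
  have m0: "0 \<le> 5 * real r * (real r - 1) * real CARD('n) * m4 M E / (2 * t2\<^sup>2)"
    using rr m4_nonneg[of M E] by simp
  have le1: "?prob \<le> measure M (space M)"
  proof -
    have "0 \<le> (real r)\<^sup>2 * q"
      by (simp add: q_def)
    then show ?thesis
      unfolding prob_space q_def[symmetric] using m0 by linarith
  qed
  have gapD: "12 * real r * t1 \<le> \<delta>" "144 * real r * (spectral_norm (E \<omega>))\<^sup>2 \<le> lam p * \<delta>"
    "144 * (spectral_norm (E \<omega>))\<^sup>2 \<le> lam p * \<delta>"
    if "\<delta> \<ge> max (12 * real r * t1) (144 * real r * (spectral_norm (E \<omega>))\<^sup>2 / \<bar>lam p\<bar>)" for \<omega>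
  proof -
    show "12 * real r * t1 \<le> \<delta>" and 2: "144 * real r * (spectral_norm (E \<omega>))\<^sup>2 \<le> lam p * \<delta>"
      using that pos by (simp_all add: field_simps)
    have "1 * (144 * (spectral_norm (E \<omega>))\<^sup>2) \<le> real r * (144 * (spectral_norm (E \<omega>))\<^sup>2)"
      by (intro mult_right_mono rr) simp
    then show "144 * (spectral_norm (E \<omega>))\<^sup>2 \<le> lam p * \<delta>"
      using 2 by simp
  qed
  have Qiff: "?Q \<omega> \<longleftrightarrow> (\<delta> \<ge> max (12 * real r * t1) (144 * real r * (spectral_norm (E \<omega>))\<^sup>2 / \<bar>lam p\<bar>) \<longrightarrow>
      (\<forall>Pt. top_eigenprojection p (A + E \<omega>) Pt \<longrightarrow> spectral_norm (Pt - Pi_p) \<le>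
        12 * sqrt (real p) * (spectral_norm (E \<omega>) / lam p + sqrt (real r) * t1 / \<delta>
          + sqrt (real r) * y0 / spectral_norm (E \<omega>) * (spectral_norm (E \<omega>) / lam p) / \<delta>)))" for \<omega>
    using pos by (simp add: Let_def y0_def)
  consider (trivial) "1 \<le> (real r)\<^sup>2 * q" | (rank1) "r = 1" | (main) "(real r)\<^sup>2 * q < 1" "2 \<le> r"
    using r1 by linarith
  then show ?thesis
  proof cases
    case trivial
    then have "?prob \<le> measure M {}"
      using m0 by (simp add: q_def)
    then show ?thesis
      unfolding with_prob_at_least_def by blast
  next
    case rank1
    \<comment> \<open>With \<open>r = 1\<close> no nonzero eigenvalue lies below the gap, so the gap may be taken to be \<open>lam p\<close>
      and the crude bound \<open>x = spectral_norm (E \<omega>)\<close> is small enough.\<close>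
    have IJ: "I - J = {}"
      using card_subset_eq[OF fin JI] cI cJ p pr rank1 by simp
    have "?Q \<omega>" if \<omega>: "\<omega> \<in> space M" for \<omega>
      unfolding Qiff
    proof (intro impI allI)
      fix Pt
      assume big: "\<delta> \<ge> max (12 * real r * t1) (144 * real r * (spectral_norm (E \<omega>))\<^sup>2 / \<bar>lam p\<bar>)"
        and Pt: "top_eigenprojection p (A + E \<omega>) Pt"
      define e where "e = spectral_norm (E \<omega>)"
      have e0: "0 \<le> e"
        by (simp add: e_def spectral_norm_nonneg)
      have e2: "144 * e\<^sup>2 \<le> lam p * lam p"
        using gapD(3)[OF big] mult_left_mono[OF dl less_imp_le[OF pos]] by (simp add: e_def)
      then have "(12 * e)\<^sup>2 \<le> (lam p)\<^sup>2"
        by (simp add: power2_eq_square)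
      then have "12 * e \<le> lam p"
        by (rule power2_le_imp_le) (use pos in simp)
      then have "spectral_norm (Pt - Pi_p) \<le> 4 * sqrt (real p) *
          (e / lam p + sqrt (real r) * e / lam p + sqrt (real r) * 0 / (lam p * lam p))"
        unfolding e_def
        by (intro det[OF \<omega> Pt pos]) (use IJ entry_le rank1 e0 e2 pos in \<open>auto simp: e_def\<close>)
      also have "\<dots> = 8 * sqrt (real p) * (e / lam p)"
        by (simp add: rank1)
      also have "\<dots> \<le> 12 * sqrt (real p) * (e / lam p)"
        using e0 pos by (intro mult_right_mono) auto
      also have "\<dots> \<le> 12 * sqrt (real p) * (e / lam p + sqrt (real r) * t1 / \<delta>
          + sqrt (real r) * y0 / e * (e / lam p) / \<delta>)"
        using e0 pos del t1 y0 by (intro mult_left_mono) (auto intro!: add_nonneg_nonneg)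
      finally show "spectral_norm (Pt - Pi_p) \<le>
        12 * sqrt (real p) * (spectral_norm (E \<omega>) / lam p + sqrt (real r) * t1 / \<delta>
          + sqrt (real r) * y0 / spectral_norm (E \<omega>) * (spectral_norm (E \<omega>) / lam p) / \<delta>)"
        by (simp add: e_def)
    qed
    then show ?thesis
      unfolding with_prob_at_least_def using le1 by blast
  next
    case main
    define R where "R = (2 * \<sigma>\<^sup>2 + K * t1) / t1"
    have D0: "0 \<le> 2 * \<sigma>\<^sup>2 + K * t1"
      using bound_nonneg t1 by simp
    have "4 * q \<le> (real r)\<^sup>2 * q"
      using main(2) power_mono[of 2 "real r" 2] by (intro mult_right_mono) (auto simp: q_def)
    then have q4: "4 * q < 1"
      using main(1) by linarith
    have "2 * \<sigma>\<^sup>2 + K * t1 \<noteq> 0"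
    proof
      assume "2 * \<sigma>\<^sup>2 + K * t1 = 0"
      then have "q = 1"
        unfolding q_def by simp
      then show False
        using q4 by simp
    qed
    then have R0: "0 < R"
      using D0 t1 by (simp add: R_def)
    have q_R: "q = exp (- (t1 / (2 * R)))"
      unfolding q_def R_def by (simp add: power2_eq_square mult.commute)
    \<comment> \<open>A nontrivial probability bound forces \<open>t1\<close> to dominate \<open>R\<close>, and thereby \<open>K\<close>.\<close>
    have "1 < t1 / (2 * R)"
    proof (rule ccontr)
      assume "\<not> 1 < t1 / (2 * R)"
      then have "exp (- 1) \<le> q"
        by (simp add: q_R)
      moreover have "1 / 3 \<le> exp (- 1 :: real)"
        using exp_le by (simp add: exp_minus field_simps)
      ultimately show False
        using q4 by linarith
    qed
    then have R2: "R \<le> t1 / 2"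
      using R0 by (simp add: field_simps)
    show ?thesis
    proof (cases "12 * real r * t1 \<le> \<delta>")
      case False
      then have "?Q \<omega>" for \<omega>
        unfolding Qiff by auto
      then show ?thesis
        unfolding with_prob_at_least_def using le1 by blast
    next
      case True
      \<comment> \<open>This \<open>h\<close> may depend on \<open>\<delta>\<close> but not on the outcome; \<open>h * R\<^sup>2 \<le> 1 / 12\<close> by the gap condition.\<close>
      define h where "h = (real r * t1 / \<delta>) / R\<^sup>2"
      have h0: "0 < h"
        using R0 t1 rr del by (simp add: h_def)
      have h4: "h * R\<^sup>2 \<le> 1 / 4"
        using R0 True del t1 by (simp add: h_def field_simps)
      obtain F where F: "F \<in> events" and prF: "?prob \<le> prob F"
        and FQ: "\<And>\<omega>. \<omega> \<in> F \<Longrightarrow> \<omega> \<in> space M"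
          "\<And>\<omega> k l. \<omega> \<in> F \<Longrightarrow> k \<in> I \<Longrightarrow> l \<in> I \<Longrightarrow> \<bar>u k \<bullet> (E \<omega> *v u l)\<bar> \<le> 2 * t1"
          "\<And>\<omega> k l. \<omega> \<in> F \<Longrightarrow> k \<in> I \<Longrightarrow> l \<in> I \<Longrightarrow> k \<noteq> l \<Longrightarrow> \<bar>u k \<bullet> (E \<omega> *v (E \<omega> *v u l))\<bar>
            \<le> y0 + (4 * h * R\<^sup>2 * (spectral_norm (E \<omega>))\<^sup>2 + (t1 / R) / h)"
        using good_event[OF u[unfolded I_def] main(2) t1 t2 R_def R0 h0 h4 less_imp_le[OF main(1)] q_R]
        unfolding I_def[symmetric] q_def[symmetric] y0_def[symmetric] by blast
      have "?Q \<omega>" if \<omega>: "\<omega> \<in> F" for \<omega>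
        unfolding Qiff
      proof (intro impI allI)
        fix Pt
        assume big: "\<delta> \<ge> max (12 * real r * t1) (144 * real r * (spectral_norm (E \<omega>))\<^sup>2 / \<bar>lam p\<bar>)"
          and Pt: "top_eigenprojection p (A + E \<omega>) Pt"
        define e where "e = spectral_norm (E \<omega>)"
        have e0: "0 \<le> e"
          by (simp add: e_def spectral_norm_nonneg)
        have x6: "real r * (2 * t1) \<le> \<delta> / 6"
          using True by simp
        note det' = det[OF FQ(1)[OF \<omega>] Pt del dl lo FQ(2)[OF \<omega>] _ _ _ x6 gapD(3)[OF big], folded e_def]
        show "spectral_norm (Pt - Pi_p) \<le>
          12 * sqrt (real p) * (spectral_norm (E \<omega>) / lam p + sqrt (real r) * t1 / \<delta>
            + sqrt (real r) * y0 / spectral_norm (E \<omega>) * (spectral_norm (E \<omega>) / lam p) / \<delta>)"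
        \<comment> \<open>Division by \<open>spectral_norm (E \<omega>)\<close> yields 0 in the first case, so the second-order term of the
          claim vanishes there, and indeed \<open>y = 0\<close> is admissible.\<close>
        proof (cases "e = 0")
          case True
          have "spectral_norm (Pt - Pi_p) \<le> 4 * sqrt (real p) *
              (e / lam p + sqrt (real r) * (2 * t1) / \<delta> + sqrt (real r) * 0 / (lam p * \<delta>))"
            by (rule det') (use t1 JI entry2_le[of _ _ \<omega>] True in \<open>auto simp: e_def\<close>)
          also have "\<dots> = 8 * sqrt (real p) * (sqrt (real r) * t1 / \<delta>)"
            using True by simp
          also have "\<dots> \<le> 12 * sqrt (real p) * (sqrt (real r) * t1 / \<delta>)"
            using t1 del by (intro mult_right_mono) auto
          finally show ?thesis
            using True by (simp add: e_def)
        next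
          case False
          define D where "D = 4 * h * R\<^sup>2 * e\<^sup>2 + (t1 / R) / h"
          have D: "D \<le> t1 * lam p"
            unfolding D_def h_def
            by (rule diagonal_part_absorbed[OF pos del dl t1 r1 _ R0 R2]) (use gapD(2)[OF big] in \<open>simp add: e_def\<close>)
          have D0: "0 \<le> D"
            using h0 t1 R0 by (simp add: D_def)
          have "spectral_norm (Pt - Pi_p) \<le> 4 * sqrt (real p) *
              (e / lam p + sqrt (real r) * (2 * t1) / \<delta> + sqrt (real r) * (y0 + D) / (lam p * \<delta>))"
          proof (rule det')
            show "\<bar>u k \<bullet> (E \<omega> *v (E \<omega> *v u l))\<bar> \<le> y0 + D" if "k \<in> I - J" "l \<in> J" for k l
              unfolding D_def e_def by (rule FQ(3)[OF \<omega>]) (use that JI in auto)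
          qed (use t1 y0 D0 in auto)
          also have "\<dots> \<le> 4 * sqrt (real p) *
              (e / lam p + sqrt (real r) * (2 * t1) / \<delta> + sqrt (real r) * (y0 + t1 * lam p) / (lam p * \<delta>))"
            using pos del D by (intro mult_left_mono add_left_mono divide_right_mono) auto
          also have "\<dots> = 4 * sqrt (real p) *
              (e / lam p + 3 * (sqrt (real r) * t1 / \<delta>) + sqrt (real r) * y0 / (lam p * \<delta>))"
            using pos del by (simp add: field_simps)
          also have "\<dots> \<le> 4 * sqrt (real p) * (3 * (e / lam p) + 3 * (sqrt (real r) * t1 / \<delta>)
              + 3 * (sqrt (real r) * y0 / (lam p * \<delta>)))"
          proof -
            have 3: "a \<le> 3 * a" if "0 \<le> a" for a :: real
              using that by simp
            show ?thesis
              by (intro mult_left_mono add_mono 3 order_refl) (use e0 pos y0 del in auto)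
          qed
          also have "\<dots> = 12 * sqrt (real p) * (e / lam p + sqrt (real r) * t1 / \<delta>
              + sqrt (real r) * y0 / e * (e / lam p) / \<delta>)"
            using False by (simp add: algebra_simps)
          finally show ?thesis
            unfolding e_def .
        qed
      qed
      then show ?thesis
        unfolding with_prob_at_least_def using F prF by blast
    qed
  qed
qed

end
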